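(* Let $k,l\geq1$ and let $P$ be a semisimple conjugacy class of $k\times k$ complex matrices with distinct eigenvalues $\zeta_1,\dots,\zeta_r$ of multiplicities $k_1,\dots,k_r$. Let $\mathcal{M}(k,l)^{0}$ denote the set of quadruples $(X,Y,F,G)\in\mathcal{M}(k,l)$ at which the action of $GL_k(\mathbb{C})$, $g.(X,Y,F,G)=(gXg^{-1},Y,gF,Gg^{-1})$, is free and proper. Then the map $(X,Y,F,G)\mapsto R(\zeta)=Y+G(\zeta-X)^{-1}F$ induces a bijection between the $GL_k(\mathbb{C})$-orbits on $\{(X,Y,F,G)\in\mathcal{M}(k,l)^0;\ X\in P\}$ and the set $\mathcal{R}_l(P)$ of all $\mathrm{Mat}_{l,l}(\mathbb{C})$-valued rational maps of the form $$R(\zeta)=Y+\sum_{i=1}^r\frac{R_i}{\zeta-\zeta_i},\qquad Y,R_i\in\mathrm{Mat}_{l,l}(\mathbb{C}),\ \operatorname{rank}R_i=k_i.$$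
   Context: $\mathcal{M}(k,l)$ is the space of quadruples $(X,Y,F,G)$ with $X\in\mathrm{Mat}_{k,k}(\mathbb{C})$, $Y\in\mathrm{Mat}_{l,l}(\mathbb{C})$, $F\in\mathrm{Mat}_{k,l}(\mathbb{C})$, $G\in\mathrm{Mat}_{l,k}(\mathbb{C})$. *)

theory Defs
  imports "HOL-Analysis.Analysis"
begin

text \<open>Quadruples (X,Y,F,G) in M(k,l): X is k x k, Y is l x l, F is k x l, G is l x k.
  The sizes k, l are the cardinalities of the finite index types 'k, 'l
  (so k, l >= 1 automatically).\<close>

type_synonym ('k, 'l) quad =
  "(complex^'k^'k) \<times> (complex^'l^'l) \<times> (complex^'l^'k) \<times> (complex^'k^'l)"

text \<open>The GL_k action g.(X,Y,F,G) = (g X g^-1, Y, g F, G g^-1).\<close>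
definition gl_act :: "complex^'k^'k \<Rightarrow> ('k::finite, 'l::finite) quad \<Rightarrow> ('k, 'l) quad" where
  "gl_act g q = (case q of (X, Y, F, G) \<Rightarrow>
     (g ** X ** matrix_inv g, Y, g ** F, G ** matrix_inv g))"

definition gl_orbit :: "('k::finite, 'l::finite) quad \<Rightarrow> ('k, 'l) quad set" where
  "gl_orbit q = {gl_act g q | g. invertible g}"

text \<open>M(k,l)^0: points where the action is free (trivial stabiliser) and proper
  (closed orbit), i.e. the GIT-stable points with trivial stabiliser.\<close>
definition M0 :: "('k::finite, 'l::finite) quad set" where
  "M0 = {q. (\<forall>g. invertible g \<and> gl_act g q = q \<longrightarrow> g = mat 1) \<and> closed (gl_orbit q)}"

definition diagonalizable :: "complex^'n^'n \<Rightarrow> bool" where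
  "diagonalizable X \<longleftrightarrow> (\<exists>S::complex^'n^'n. invertible S \<and>
      (\<forall>i j. i \<noteq> j \<longrightarrow> (S ** X ** matrix_inv S) $ i $ j = 0))"

definition eigenspace :: "complex^'n^'n \<Rightarrow> complex \<Rightarrow> (complex^'n) set" where
  "eigenspace X c = {v. X *v v = c *s v}"

definition eigenvalues :: "complex^'n^'n \<Rightarrow> complex set" where
  "eigenvalues X = {c. \<exists>v. v \<noteq> 0 \<and> X *v v = c *s v}"

text \<open>P is the conjugacy class of a semisimple matrix whose distinct eigenvalues are
  zeta 0, ..., zeta (r-1), with multiplicities kk 0, ..., kk (r-1).\<close>
definition semisimple_class ::
  "(complex^'n^'n) set \<Rightarrow> nat \<Rightarrow> (nat \<Rightarrow> complex) \<Rightarrow> (nat \<Rightarrow> nat) \<Rightarrow> bool" where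
  "semisimple_class P r zeta kk \<longleftrightarrow> (\<exists>X0. diagonalizable X0 \<and>
      P = {g ** X0 ** matrix_inv g | g :: complex^'n^'n. invertible g} \<and>
      inj_on zeta {..<r} \<and> eigenvalues X0 = zeta ` {..<r} \<and>
      (\<forall>i<r. vec.dim (eigenspace X0 (zeta i)) = kk i))"

text \<open>Rational matrix-valued maps are represented as functions on C, set to 0 at the
  (finitely many) poles zeta ` {..<r}; two rational maps agree iff they agree off
  this finite set.\<close>
definition transfer_map ::
  "nat \<Rightarrow> (nat \<Rightarrow> complex) \<Rightarrow> ('k::finite, 'l::finite) quad \<Rightarrow> complex \<Rightarrow> complex^'l^'l" where
  "transfer_map r zeta q = (case q of (X, Y, F, G) \<Rightarrow>
     (\<lambda>z. if z \<in> zeta ` {..<r} then 0 else Y + G ** matrix_inv (mat z - X) ** F))"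

definition rat_maps_R ::
  "nat \<Rightarrow> (nat \<Rightarrow> complex) \<Rightarrow> (nat \<Rightarrow> nat) \<Rightarrow> (complex \<Rightarrow> complex^'l::finite^'l) set" where
  "rat_maps_R r zeta kk =
     {(\<lambda>z. if z \<in> zeta ` {..<r} then 0
           else Y + (\<Sum>i<r. mat (inverse (z - zeta i)) ** Rs i)) | Y Rs.
        \<forall>i<r. rank (Rs i) = kk i}"

end

theory Submission
  imports Defs
begin

text \<open>Fix \<open>X \<in> P\<close> with spectral projectors \<open>Pr i\<close>, so that \<open>X Pr\<^sub>i = \<zeta>\<^sub>i Pr\<^sub>i\<close> and
  \<open>\<Sum> Pr\<^sub>i = 1\<close>. Then \<open>(\<zeta> - X)\<^sup>-\<^sup>1 = \<Sum> Pr\<^sub>i / (\<zeta> - \<zeta>\<^sub>i)\<close>, so the transfer map is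
  \<open>Y + \<Sum> G Pr\<^sub>i F / (\<zeta> - \<zeta>\<^sub>i)\<close>, with residues \<open>G Pr\<^sub>i F\<close>.

  The quadruple lies in \<open>M(k,l)\<^sup>0\<close> exactly when, for every \<open>i\<close>, \<open>G\<close> is injective on the
  eigenspace \<open>range Pr\<^sub>i\<close> and \<open>Pr\<^sub>i F\<close> maps onto it. If \<open>G\<close> kills an eigenvector (or \<open>F\<close>
  is killed by a left eigenvector), dilating along the corresponding rank-one idempotent
  produces a point in the closure of the orbit with a nontrivial stabiliser. Conversely, for
  such data the group element is recovered continuously from the orbit point, because the
  projectors are Lagrange polynomials in \<open>X\<close>; hence the orbit is closed.

  For these data the residues have rank \<open>k\<^sub>i\<close>. Equal transfer maps have equal residues by
  uniqueness of partial fractions, and the blockwise map \<open>\<Sum> Pr'\<^sub>j F' M\<^sub>j Pr\<^sub>j\<close> (with \<open>M\<^sub>j\<close>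
  a right inverse of \<open>Pr\<^sub>j F\<close>) then conjugates one quadruple into the other. Finally, a
  residue of rank \<open>k\<^sub>i\<close> factors through \<open>Pr\<^sub>i\<close>, which gives a preimage.\<close>

section \<open>Matrix algebra over a field\<close>

lemma mat_matrix_mult: "mat c ** (A::'a::semiring_1^'n^'m) = (\<chi> i j. c * A$i$j)"
  unfolding matrix_matrix_mult_def mat_def
  by (auto simp: vec_eq_iff if_distrib if_distribR sum.delta'[OF finite] cong: if_cong)

lemma matrix_mult_mat_left_commute:
  "A ** (mat c ** B) = mat c ** (A ** (B::'a::comm_semiring_1^'p^'n))"
  unfolding mat_matrix_mult by (simp add: matrix_matrix_mult_def vec_eq_iff sum_distrib_left mult_ac)

lemma matrix_mult_mat_sandwich:
  "A ** (mat c ** B) ** C = mat c ** (A ** B ** (C::'a::comm_semiring_1^'p^'n))"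
  by (simp add: matrix_mult_mat_left_commute[of A] matrix_mul_assoc[symmetric])

lemma mat_mult_mat: "mat a ** mat b = (mat (a * b) :: 'a::semiring_1^'n^'n)"
  unfolding mat_matrix_mult by (simp add: vec_eq_iff mat_def)

lemma mat_matrix_mult_mat_matrix:
  "(mat a ** A) ** (mat b ** B) = mat (a * b) ** (A ** (B::'a::comm_semiring_1^'p^'n))"
proof -
  have "(mat a ** A) ** (mat b ** B) = mat a ** (A ** (mat b ** B))" by (simp add: matrix_mul_assoc)
  also have "A ** (mat b ** B) = mat b ** (A ** B)" by (rule matrix_mult_mat_left_commute)
  finally show ?thesis by (simp add: matrix_mul_assoc mat_mult_mat)
qed

lemma mat_add_mat: "mat a + mat b = (mat (a + b) :: 'a::semiring_1^'n^'n)"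
  by (simp add: vec_eq_iff mat_def)

lemma mat_diff_mat: "mat a - mat b = (mat (a - b) :: 'a::ring_1^'n^'n)"
  by (simp add: vec_eq_iff mat_def)

lemma mat_minus_one_mult: "mat (-1) ** A = - (A::'a::ring_1^'m^'n)"
  unfolding mat_matrix_mult by (simp add: vec_eq_iff)

lemma matrix_add_rdistrib: "(A + B) ** C = A ** C + B ** (C::'a::semiring_1^'p^'n)"
  by (vector matrix_matrix_mult_def sum.distrib[symmetric] field_simps)

lemma matrix_diff_ldistrib: "A ** (B - C) = A ** B - A ** (C::'a::ring_1^'p^'n)"
  by (vector matrix_matrix_mult_def sum_subtractf[symmetric] algebra_simps)

lemma matrix_diff_rdistrib: "(A - B) ** C = A ** C - B ** (C::'a::ring_1^'p^'n)"
  by (vector matrix_matrix_mult_def sum_subtractf[symmetric] algebra_simps)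

lemma matrix_sum_ldistrib: "A ** sum B I = (\<Sum>i\<in>I. A ** B i)"
  by (induction I rule: infinite_finite_induct) (auto simp: matrix_add_ldistrib)

lemma matrix_sum_rdistrib: "sum B I ** A = (\<Sum>i\<in>I. B i ** A)"
  by (induction I rule: infinite_finite_induct) (auto simp: matrix_add_rdistrib)

lemma sum_matrix_vector_mult: "sum A I *v v = (\<Sum>i\<in>I. A i *v v)"
  by (induction I rule: infinite_finite_induct) (auto simp: matrix_vector_mult_add_rdistrib)

lemma mat_matrix_vector_mult: "(mat c ** A) *v v = c *s (A *v v)"
  unfolding mat_matrix_mult by (simp add: vec_eq_iff matrix_vector_mult_def sum_distrib_left mult_ac)

lemma vector_matrix_mult_mat: "u v* (mat c ** A) = c *s (u v* (A::'a::comm_semiring_1^'m^'n))"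
  unfolding mat_matrix_mult vector_matrix_mult_def by (simp add: vec_eq_iff sum_distrib_left mult_ac)

lemma matrix_inv_unique:
  fixes A B :: "'a::field^'n^'n"
  assumes "A ** B = mat 1"
  shows "invertible A" "matrix_inv A = B"
proof -
  have BA: "B ** A = mat 1" using assms matrix_left_right_inverse by blast
  then show "invertible A" using assms invertible_def by blast
  have "A ** matrix_inv A = mat 1 \<and> matrix_inv A ** A = mat 1"
    unfolding matrix_inv_def by (rule someI[of _ B]) (use assms BA in simp)
  then have "matrix_inv A = matrix_inv A ** (A ** B)" using assms by simp
  also have "\<dots> = B" by (simp add: matrix_mul_assoc \<open>_ \<and> _\<close>)
  finally show "matrix_inv A = B" .
qed

lemma matrix_inv_right: "invertible (A::'a::field^'n^'n) \<Longrightarrow> A ** matrix_inv A = mat 1"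
  unfolding invertible_def matrix_inv_def by (rule conjunct1[OF someI_ex]) blast

lemma matrix_inv_left: "invertible (A::'a::field^'n^'n) \<Longrightarrow> matrix_inv A ** A = mat 1"
  unfolding invertible_def matrix_inv_def by (rule conjunct2[OF someI_ex]) blast

lemma matrix_inv_vector_left: "invertible (A::'a::field^'n^'n) \<Longrightarrow> matrix_inv A *v (A *v x) = x"
  by (simp add: matrix_vector_mul_assoc matrix_inv_left)

lemma matrix_inv_vector_right: "invertible (A::'a::field^'n^'n) \<Longrightarrow> A *v (matrix_inv A *v x) = x"
  by (simp add: matrix_vector_mul_assoc matrix_inv_right)

lemma invertible_matrix_inv: "invertible (A::'a::field^'n^'n) \<Longrightarrow> invertible (matrix_inv A)"
  using matrix_inv_unique(1)[OF matrix_inv_left] .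

lemma matrix_inv_matrix_inv: "invertible (A::'a::field^'n^'n) \<Longrightarrow> matrix_inv (matrix_inv A) = A"
  using matrix_inv_unique(2)[OF matrix_inv_left] .

lemma matrix_inv_mult:
  fixes A B :: "'a::field^'n^'n"
  assumes "invertible A" "invertible B"
  shows "matrix_inv (A ** B) = matrix_inv B ** matrix_inv A"
proof (rule matrix_inv_unique(2))
  have "A ** B ** (matrix_inv B ** matrix_inv A) = A ** (B ** matrix_inv B) ** matrix_inv A"
    by (simp add: matrix_mul_assoc)
  then show "A ** B ** (matrix_inv B ** matrix_inv A) = mat 1"
    using assms by (simp add: matrix_inv_right)
qed

lemma matrix_inv_mat_1: "matrix_inv (mat 1 :: 'a::field^'n^'n) = mat 1"
  using matrix_inv_unique(2)[of "mat 1" "mat 1"] by simp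

lemma invertible_mat_1: "invertible (mat 1 :: 'a::field^'n^'n)"
  using matrix_inv_unique(1)[of "mat 1" "mat 1"] by simp

lemma conjugate_mult:
  fixes g A B :: "'a::field^'n^'n"
  assumes "invertible g"
  shows "(g ** A ** matrix_inv g) ** (g ** B ** matrix_inv g) = g ** (A ** B) ** matrix_inv g"
proof -
  have "(g ** A ** matrix_inv g) ** (g ** B ** matrix_inv g) = g ** A ** (matrix_inv g ** g) ** B ** matrix_inv g"
    by (simp add: matrix_mul_assoc)
  then show ?thesis using assms by (simp add: matrix_inv_left matrix_mul_assoc)
qed

lemma tendsto_matrix_mult [tendsto_intros]:
  fixes A :: "'b \<Rightarrow> 'a::real_normed_field^'n^'m" and B :: "'b \<Rightarrow> 'a^'p^'n"
  assumes "(A \<longlongrightarrow> A0) F" "(B \<longlongrightarrow> B0) F"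
  shows "((\<lambda>x. A x ** B x) \<longlongrightarrow> A0 ** B0) F"
proof (intro vec_tendstoI)
  fix i j
  have entry: "((\<lambda>x. M x $ i $ k) \<longlongrightarrow> M0 $ i $ k) F" if "(M \<longlongrightarrow> M0) F" for M :: "'b \<Rightarrow> 'a^'q^'r" and M0 i k
    using tendsto_vec_nth[OF tendsto_vec_nth[OF that]] .
  show "((\<lambda>x. (A x ** B x) $ i $ j) \<longlongrightarrow> (A0 ** B0) $ i $ j) F"
    unfolding matrix_matrix_mult_def vec_lambda_beta
    by (intro tendsto_sum tendsto_mult entry assms)
qed

lemma tendsto_mat [tendsto_intros]:
  assumes "(f \<longlongrightarrow> c) F"
  shows "((\<lambda>x. mat (f x) :: 'a::real_normed_field^'n^'n) \<longlongrightarrow> mat c) F"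
proof (intro vec_tendstoI)
  fix i j :: 'n
  show "((\<lambda>x. mat (f x) $ i $ j) \<longlongrightarrow> mat c $ i $ j) F"
    using assms by (cases "i = j") (simp_all add: mat_def)
qed

section \<open>Rank and one-sided inverses\<close>

lemma dim_range_le_dim_rows:
  fixes A :: "'a::field^'n^'m"
  shows "vec.dim (range ((*v) A)) \<le> vec.dim (rows A)"
proof -
  obtain B where B: "B \<subseteq> rows A" "vec.independent B" "rows A \<subseteq> vec.span B" "card B = vec.dim (rows A)"
    using vec.basis_exists[of "rows A"] by blast
  have fB: "finite B" using B(2) vec.finiteI_independent by blast
  have "\<forall>i. \<exists>u. row i A = (\<Sum>b\<in>B. u b *s b)"
    using B(3) vec.span_finite[OF fB] unfolding rows_def by blast
  then obtain u where u: "\<And>i. row i A = (\<Sum>b\<in>B. u i b *s b)" by metis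
  define c where "c b = (\<chi> i. u i b)" for b
  have "A *v x = (\<Sum>b\<in>B. (\<Sum>j\<in>UNIV. b$j * x$j) *s c b)" for x
  proof -
    have "(A *v x) $ i = (\<Sum>b\<in>B. (\<Sum>j\<in>UNIV. b$j * x$j) * u i b)" for i
    proof -
      have "A $ i = row i A" by (simp add: row_def vec_eq_iff)
      then have "(A *v x) $ i = (\<Sum>j\<in>UNIV. (\<Sum>b\<in>B. u i b * b $ j) * x $ j)"
        by (simp add: matrix_vector_mult_def u)
      then show ?thesis
        by (simp add: sum_distrib_left sum_distrib_right mult_ac sum.swap[of _ B])
    qed
    then show ?thesis by (simp add: vec_eq_iff c_def)
  qed
  then have "range ((*v) A) \<subseteq> vec.span (c ` B)"
    by (auto intro!: vec.span_sum vec.span_scale intro: vec.span_base)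
  then have "vec.dim (range ((*v) A)) \<le> card (c ` B)"
    using vec.dim_le_card fB by blast
  also have "\<dots> \<le> card B" using fB card_image_le by blast
  finally show ?thesis using B(4) by simp
qed

lemma column_eq_matrix_vector_mult_axis: "column i (A::'a::comm_semiring_1^'n^'m) = A *v axis i 1"
  by (simp add: column_def matrix_vector_mult_def axis_def vec_eq_iff if_distrib if_distribR cong: if_cong)

lemma columns_subset_range: "columns (A::'a::field^'n^'m) \<subseteq> range ((*v) A)"
  unfolding columns_def by (auto simp: column_eq_matrix_vector_mult_axis)

lemma rank_dim_range_gen:
  fixes A :: "'a::field^'n^'m"
  shows "rank A = vec.dim (range ((*v) A))"
proof -
  have "vec.dim (rows A) = vec.dim (columns (transpose A))" by simp
  also have "\<dots> \<le> vec.dim (range ((*v) (transpose A)))"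
    by (rule vec.dim_subset[OF columns_subset_range])
  also have "\<dots> \<le> vec.dim (rows (transpose A))" by (rule dim_range_le_dim_rows)
  also have "\<dots> = vec.dim (columns A)" by simp
  also have "\<dots> \<le> vec.dim (range ((*v) A))" by (rule vec.dim_subset[OF columns_subset_range])
  finally show ?thesis using dim_range_le_dim_rows[of A] unfolding row_rank_def_gen by simp
qed

lemma range_matrix_mult: "range ((*v) (A ** B)) = (*v) A ` range ((*v) B)"
  by (auto simp: matrix_vector_mul_assoc[symmetric] image_iff)

lemma rank_matrix_mult_le_left: "rank (A ** B) \<le> rank (A::'a::field^'n^'m)"
  unfolding rank_dim_range_gen range_matrix_mult by (rule vec.dim_subset) auto

lemma rank_matrix_mult_le_right: "rank (A ** B) \<le> rank (B::'a::field^'n^'m)"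
  unfolding rank_dim_range_gen range_matrix_mult
  by (rule vec.dim_image_le[OF matrix_vector_mul_linear_gen])

lemma idempotent_fixes_range:
  assumes "P ** P = P" "x \<in> range ((*v) P)"
  shows "P *v x = x"
proof -
  obtain y where "x = P *v y" using assms(2) by blast
  then show ?thesis using assms(1) by (simp add: matrix_vector_mul_assoc)
qed

lemma subspace_range_matrix: "vec.subspace (range ((*v) (A::'a::field^'n^'m)))"
  using vec.linear_subspace_image[OF matrix_vector_mul_linear_gen vec.subspace_UNIV, of A] by simp

lemma exists_right_factor:
  fixes A :: "'a::field^'n^'m" and B :: "'a^'p^'m"
  assumes "range ((*v) B) \<subseteq> range ((*v) A)"
  shows "\<exists>M. A ** M = B"
proof -
  have "\<forall>a. \<exists>y. A *v y = B *v axis a 1"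
    using assms by (metis (no_types, lifting) UNIV_I image_eqI image_iff subset_iff)
  then obtain y where y: "\<And>a. A *v y a = B *v axis a 1" by metis
  have "A ** transpose (\<chi> a. y a) = B"
  proof -
    have "(A ** transpose (\<chi> a. y a)) $ i $ a = (A *v y a) $ i" for i a
      by (simp add: matrix_matrix_mult_def matrix_vector_mult_def transpose_def)
    then show ?thesis by (simp add: vec_eq_iff y column_eq_matrix_vector_mult_axis[symmetric] column_def)
  qed
  then show ?thesis ..
qed

lemma exists_left_inverse_on_range:
  fixes P :: "'a::field^'n^'n" and G :: "'a^'n^'m"
  assumes "P ** P = P" and inj: "\<And>x. P *v x = x \<Longrightarrow> G *v x = 0 \<Longrightarrow> x = 0"
  shows "\<exists>N. N ** G ** P = P"
proof -
  have "inj_on ((*v) G) (range ((*v) P))"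
  proof (rule inj_onI)
    fix x y assume x: "x \<in> range ((*v) P)" and y: "y \<in> range ((*v) P)" and Gxy: "G *v x = G *v y"
    have "P *v (x - y) = x - y"
      using idempotent_fixes_range[OF assms(1) x] idempotent_fixes_range[OF assms(1) y]
      by (simp add: matrix_vector_mult_diff_distrib)
    moreover have "G *v (x - y) = 0" using Gxy by (simp add: matrix_vector_mult_diff_distrib)
    ultimately show "x = y" using inj[of "x - y"] by simp
  qed
  then obtain g where g: "Vector_Spaces.linear (*s) (*s) g" "\<forall>v\<in>range ((*v) P). g (G *v v) = v"
    using vec.linear_exists_left_inverse_on[OF matrix_vector_mul_linear_gen subspace_range_matrix]
    by blast
  have "matrix g ** G ** P *v x = P *v x" for x
    using g(2) by (simp add: matrix_vector_mul_assoc[symmetric] matrix_works[OF g(1)])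
  then have "matrix g ** G ** P = P" by (simp add: matrix_eq)
  then show ?thesis ..
qed

lemma exists_right_inverse_on_range:
  fixes P :: "'a::field^'n^'n" and F :: "'a^'m^'n"
  assumes "P ** P = P" and inj: "\<And>u. u v* P = u \<Longrightarrow> u v* F = 0 \<Longrightarrow> u = 0"
  shows "\<exists>M. P ** F ** M = P"
proof -
  have "transpose P ** transpose P = transpose P"
    using assms(1) by (metis matrix_transpose_mul)
  then obtain N where "N ** transpose F ** transpose P = transpose P"
    using exists_left_inverse_on_range[of "transpose P" "transpose F"] inj by auto
  then have "P ** F ** transpose N = P"
    by (metis matrix_mul_assoc matrix_transpose_mul transpose_transpose)
  then show ?thesis ..
qed

lemma cancel_by_left_inverse:
  fixes P :: "'a::comm_semiring_1^'n^'n" and Z W :: "'a^'m^'n"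
  assumes "N ** G ** P = P" "P ** Z = Z" "P ** W = W" "G ** Z = G ** W"
  shows "Z = W"
proof -
  have "Z = N ** G ** P ** Z" using assms(1,2) by simp
  also have "\<dots> = N ** (G ** Z)" using assms(2) by (simp add: matrix_mul_assoc[symmetric])
  also have "\<dots> = N ** G ** P ** W" using assms(3,4) by (simp add: matrix_mul_assoc[symmetric])
  finally show ?thesis using assms(1,3) by simp
qed

lemma exists_factorization_through_idempotent:
  fixes R :: "'a::field^'l^'l" and P :: "'a^'k^'k"
  assumes P: "P ** P = P" and rank: "rank R = rank P"
  shows "\<exists>A B M N. R = A ** P ** B \<and> P ** B ** M = P \<and> N ** A ** P = P"
proof -
  let ?W = "range ((*v) R)" and ?V = "range ((*v) P)"
  obtain BW where BW: "BW \<subseteq> ?W" "vec.independent BW" "?W \<subseteq> vec.span BW" "card BW = vec.dim ?W"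
    using vec.basis_exists by blast
  obtain BV where BV: "BV \<subseteq> ?V" "vec.independent BV" "?V \<subseteq> vec.span BV" "card BV = vec.dim ?V"
    using vec.basis_exists by blast
  have "vec.dim ?W = vec.dim ?V" using rank by (simp add: rank_dim_range_gen)
  then obtain f :: "'a^'l \<Rightarrow> 'a^'k" where f: "Vector_Spaces.linear (*s) (*s) f" "f ` ?W = ?V" "inj_on f ?W"
    using vec.basis_to_basis_subspace_isomorphism[OF subspace_range_matrix subspace_range_matrix _ BW BV]
    by blast
  obtain g :: "'a^'k \<Rightarrow> 'a^'l" where g: "Vector_Spaces.linear (*s) (*s) g" "\<forall>w\<in>?W. g (f w) = w"
    using vec.linear_exists_left_inverse_on[OF f(1) subspace_range_matrix f(3)] by blast
  have f_mv: "matrix f *v x = f x" and g_mv: "matrix g *v y = g y" for x y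
    using matrix_works[OF f(1)] matrix_works[OF g(1)] by simp_all
  have range_fR: "range ((*v) (matrix f ** R)) = ?V"
    unfolding range_matrix_mult using f(2) by (simp add: f_mv image_image)
  have "matrix g ** P ** (matrix f ** R) *v x = R *v x" for x
  proof -
    have "f (R *v x) \<in> ?V" using f(2) by blast
    then have "P *v f (R *v x) = f (R *v x)" by (rule idempotent_fixes_range[OF P])
    then show ?thesis using g(2) by (simp add: matrix_vector_mul_assoc[symmetric] f_mv g_mv)
  qed
  then have R_eq: "R = matrix g ** P ** (matrix f ** R)" by (simp add: matrix_eq)
  obtain M where M: "matrix f ** R ** M = P"
    using exists_right_factor[of P "matrix f ** R"] range_fR by auto
  have "P ** (matrix f ** R) ** M = P ** (matrix f ** R ** M)" by (simp only: matrix_mul_assoc)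
  then have PM: "P ** (matrix f ** R) ** M = P" using P by (simp add: M)
  obtain N where N: "N ** matrix g ** P = P"
  proof (rule exists_left_inverse_on_range[OF P, THEN exE])
    fix v assume v: "P *v v = v" and gv: "matrix g *v v = 0"
    have "v \<in> f ` ?W" unfolding f(2) by (metis v rangeI)
    then obtain w where "w \<in> ?W" "v = f w" by blast
    then show "v = 0" using gv g(2) vec.linear_0[OF f(1)] by (simp add: g_mv)
  qed
  show ?thesis using R_eq PM N by blast
qed

section \<open>Spectral decompositions\<close>

locale spectral_decomposition =
  fixes X :: "complex^'n^'n" and r :: nat and zeta :: "nat \<Rightarrow> complex"
    and Pr :: "nat \<Rightarrow> complex^'n^'n"
  assumes zeta_inj: "inj_on zeta {..<r}"
    and sum_proj: "(\<Sum>i<r. Pr i) = mat 1"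
    and proj_mult_proj: "\<And>i j. i < r \<Longrightarrow> j < r \<Longrightarrow> Pr i ** Pr j = (if i = j then Pr i else 0)"
    and X_mult_proj: "\<And>i. i < r \<Longrightarrow> X ** Pr i = mat (zeta i) ** Pr i"
    and proj_mult_X: "\<And>i. i < r \<Longrightarrow> Pr i ** X = mat (zeta i) ** Pr i"
begin

lemma proj_idem: "i < r \<Longrightarrow> Pr i ** Pr i = Pr i"
  using proj_mult_proj by simp

lemma sum_mult_proj: "i < r \<Longrightarrow> (\<Sum>j<r. A j ** Pr j) ** Pr i = A i ** Pr i"
  by (simp add: matrix_sum_rdistrib matrix_mul_assoc[symmetric] proj_mult_proj if_distrib cong: if_cong)

lemma proj_mult_sum: "i < r \<Longrightarrow> Pr i ** (\<Sum>j<r. Pr j ** A j) = Pr i ** A i"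
  by (simp add: matrix_sum_ldistrib matrix_mul_assoc proj_mult_proj if_distrib if_distribR cong: if_cong)

lemma matrix_eq_by_proj_right:
  assumes "\<And>i. i < r \<Longrightarrow> A ** Pr i = B ** Pr i"
  shows "A = B"
proof -
  have "A = A ** (\<Sum>i<r. Pr i)" by (simp add: sum_proj)
  also have "\<dots> = B ** (\<Sum>i<r. Pr i)" by (simp add: matrix_sum_ldistrib assms)
  finally show ?thesis by (simp add: sum_proj)
qed

lemma matrix_eq_by_proj_left:
  assumes "\<And>i. i < r \<Longrightarrow> Pr i ** A = Pr i ** B"
  shows "A = B"
proof -
  have "A = (\<Sum>i<r. Pr i) ** A" by (simp add: sum_proj)
  also have "\<dots> = (\<Sum>i<r. Pr i) ** B" by (simp add: matrix_sum_rdistrib assms)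
  finally show ?thesis by (simp add: sum_proj)
qed

lemma eigenspace_eq_range_proj:
  assumes i: "i < r"
  shows "eigenspace X (zeta i) = range ((*v) (Pr i))"
proof (intro set_eqI iffI)
  fix v assume "v \<in> eigenspace X (zeta i)"
  then have Xv: "X *v v = zeta i *s v" by (simp add: eigenspace_def)
  have other: "Pr j *v v = 0" if j: "j < r" "j \<noteq> i" for j
  proof -
    have "zeta j *s (Pr j *v v) = zeta i *s (Pr j *v v)"
      using Xv by (metis matrix_vector_mul_assoc mat_matrix_vector_mult proj_mult_X[OF j(1)]
          vec.scale vector_scalar_commute)
    moreover have "zeta j \<noteq> zeta i" using zeta_inj i j by (auto simp: inj_on_def)
    ultimately show ?thesis by (simp add: vec.scale_cancel_right)
  qed
  have "v = (\<Sum>j<r. Pr j) *v v" by (simp add: sum_proj)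
  also have "\<dots> = (\<Sum>j<r. Pr j *v v)" by (rule sum_matrix_vector_mult)
  also have "\<dots> = Pr i *v v"
    using i other by (simp add: sum.remove[of "{..<r}" i])
  finally have "v = Pr i *v v" .
  then show "v \<in> range ((*v) (Pr i))" by (metis rangeI)
next
  fix v assume "v \<in> range ((*v) (Pr i))"
  then obtain w where "v = Pr i *v w" by blast
  then show "v \<in> eigenspace X (zeta i)"
    using X_mult_proj[OF i] by (simp add: eigenspace_def matrix_vector_mul_assoc mat_matrix_vector_mult)
qed

lemma conjugate:
  fixes g :: "complex^'n^'n"
  assumes g: "invertible g"
  shows "spectral_decomposition (g ** X ** matrix_inv g) r zeta (\<lambda>i. g ** Pr i ** matrix_inv g)"
proof
  show "(\<Sum>i<r. g ** Pr i ** matrix_inv g) = mat 1"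
    using g by (simp add: matrix_sum_ldistrib[symmetric] matrix_sum_rdistrib[symmetric] sum_proj
        matrix_inv_right)
  show "(g ** Pr i ** matrix_inv g) ** (g ** Pr j ** matrix_inv g) =
      (if i = j then g ** Pr i ** matrix_inv g else 0)" if "i < r" "j < r" for i j
    using that g by (simp add: conjugate_mult proj_mult_proj)
  have scalar: "g ** (mat c ** A) ** matrix_inv g = mat c ** (g ** A ** matrix_inv g)" for c A
    by (simp add: matrix_mult_mat_left_commute matrix_mul_assoc[symmetric])
  show "g ** X ** matrix_inv g ** (g ** Pr i ** matrix_inv g) = mat (zeta i) ** (g ** Pr i ** matrix_inv g)"
    and "g ** Pr i ** matrix_inv g ** (g ** X ** matrix_inv g) = mat (zeta i) ** (g ** Pr i ** matrix_inv g)"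
    if "i < r" for i
    using that by (simp_all add: conjugate_mult[OF g] X_mult_proj proj_mult_X scalar)
qed (rule zeta_inj)

lemma resolvent:
  assumes z: "z \<notin> zeta ` {..<r}"
  shows "invertible (mat z - X)"
    and "matrix_inv (mat z - X) = (\<Sum>i<r. mat (inverse (z - zeta i)) ** Pr i)"
proof -
  have "(mat z - X) ** (mat (inverse (z - zeta i)) ** Pr i) = Pr i" if i: "i < r" for i
  proof -
    have "(mat z - X) ** Pr i = mat (z - zeta i) ** Pr i"
      using i by (simp add: matrix_diff_rdistrib X_mult_proj mat_diff_mat[symmetric])
    moreover have "z - zeta i \<noteq> 0" using z i by auto
    ultimately have "mat (inverse (z - zeta i)) ** ((mat z - X) ** Pr i) = Pr i"
      by (simp add: matrix_mul_assoc mat_mult_mat)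
    then show ?thesis by (simp add: matrix_mult_mat_left_commute)
  qed
  then have "(mat z - X) ** (\<Sum>i<r. mat (inverse (z - zeta i)) ** Pr i) = mat 1"
    by (simp add: matrix_sum_ldistrib sum_proj)
  then show "invertible (mat z - X)"
    and "matrix_inv (mat z - X) = (\<Sum>i<r. mat (inverse (z - zeta i)) ** Pr i)"
    by (rule matrix_inv_unique)+
qed

lemma transfer_map_eq:
  "transfer_map r zeta (X, Y, F, G) = (\<lambda>z. if z \<in> zeta ` {..<r} then 0
     else Y + (\<Sum>i<r. mat (inverse (z - zeta i)) ** (G ** Pr i ** F)))"
proof
  fix z
  have "G ** (\<Sum>i<r. mat (inverse (z - zeta i)) ** Pr i) ** F =
      (\<Sum>i<r. mat (inverse (z - zeta i)) ** (G ** Pr i ** F))"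
    by (simp add: matrix_sum_ldistrib matrix_sum_rdistrib matrix_mult_mat_sandwich)
  then show "transfer_map r zeta (X, Y, F, G) z = (if z \<in> zeta ` {..<r} then 0
     else Y + (\<Sum>i<r. mat (inverse (z - zeta i)) ** (G ** Pr i ** F)))"
    by (simp add: transfer_map_def resolvent(2))
qed

text \<open>A matrix commuting with \<open>X\<close> preserves every eigenspace, so the off-diagonal
  blocks \<open>Pr j ** A ** Pr i\<close> vanish.\<close>
lemma commute_proj:
  assumes AX: "A ** X = X ** A" and i: "i < r"
  shows "A ** Pr i = Pr i ** A"
proof -
  have block: "Pr j ** A ** Pr k = 0" if "j < r" "k < r" "j \<noteq> k" for j k
  proof -
    have "mat (zeta j) ** (Pr j ** A ** Pr k) = Pr j ** X ** A ** Pr k"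
      using that by (simp add: proj_mult_X matrix_mul_assoc)
    also have "\<dots> = Pr j ** A ** (X ** Pr k)" by (metis AX matrix_mul_assoc)
    also have "\<dots> = mat (zeta k) ** (Pr j ** A ** Pr k)"
      using that by (simp add: X_mult_proj matrix_mult_mat_left_commute)
    finally have "mat (zeta j - zeta k) ** (Pr j ** A ** Pr k) = 0"
      by (simp add: mat_diff_mat[symmetric] matrix_diff_rdistrib)
    then have "mat (inverse (zeta j - zeta k)) ** (mat (zeta j - zeta k) ** (Pr j ** A ** Pr k)) = 0"
      by simp
    moreover have "zeta j - zeta k \<noteq> 0" using zeta_inj that by (auto simp: inj_on_def)
    ultimately show ?thesis by (simp add: matrix_mul_assoc mat_mult_mat)
  qed
  have "A ** Pr i = Pr i ** A ** Pr i"
  proof (rule matrix_eq_by_proj_left)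
    fix j assume "j < r"
    then show "Pr j ** (A ** Pr i) = Pr j ** (Pr i ** A ** Pr i)"
      using i block[of j i] by (cases "j = i") (simp_all add: matrix_mul_assoc proj_mult_proj)
  qed
  moreover have "Pr i ** A = Pr i ** A ** Pr i"
  proof (rule matrix_eq_by_proj_right)
    fix j assume "j < r"
    then show "Pr i ** A ** Pr j = Pr i ** A ** Pr i ** Pr j"
      using i block[of i j] by (cases "j = i") (simp_all add: matrix_mul_assoc[symmetric] proj_mult_proj)
  qed
  ultimately show ?thesis by simp
qed

end

text \<open>The Lagrange polynomial \<open>\<Prod>\<^sub>j\<^sub>\<noteq>\<^sub>i (A - \<zeta>\<^sub>j) / (\<zeta>\<^sub>i - \<zeta>\<^sub>j)\<close>: it computes the spectral
  projectors of a matrix, and does so continuously.\<close>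
definition lagrange_projector :: "nat \<Rightarrow> (nat \<Rightarrow> complex) \<Rightarrow> nat \<Rightarrow> complex^'n^'n \<Rightarrow> complex^'n^'n" where
  "lagrange_projector r zeta i A =
     foldr (\<lambda>j M. mat (inverse (zeta i - zeta j)) ** (A - mat (zeta j)) ** M) [j \<leftarrow> [0..<r]. j \<noteq> i] (mat 1)"

lemma tendsto_lagrange_projector:
  fixes A :: "'b \<Rightarrow> complex^'n^'n"
  assumes "(A \<longlongrightarrow> A0) F"
  shows "((\<lambda>x. lagrange_projector r zeta i (A x)) \<longlongrightarrow> lagrange_projector r zeta i A0) F"
proof -
  have "((\<lambda>x. foldr (\<lambda>j M. mat (c j) ** (A x - mat (zeta j)) ** M) js (mat 1)) \<longlongrightarrow>
      foldr (\<lambda>j M. mat (c j) ** (A0 - mat (zeta j)) ** M) js (mat 1)) F" for c js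
    by (induction js) (auto intro!: tendsto_intros assms)
  then show ?thesis unfolding lagrange_projector_def .
qed

context spectral_decomposition
begin

lemma foldr_mult_proj:
  assumes m: "m < r"
  shows "foldr (\<lambda>j M. mat (c j) ** (X - mat (zeta j)) ** M) js (mat 1) ** Pr m =
    mat (\<Prod>j\<leftarrow>js. c j * (zeta m - zeta j)) ** Pr m"
proof (induction js)
  case (Cons j js)
  let ?M = "foldr (\<lambda>j M. mat (c j) ** (X - mat (zeta j)) ** M) js (mat 1)"
  let ?p = "\<Prod>j\<leftarrow>js. c j * (zeta m - zeta j)"
  have XPm: "(X - mat (zeta j)) ** Pr m = mat (zeta m - zeta j) ** Pr m"
    using m by (simp add: matrix_diff_rdistrib X_mult_proj mat_diff_mat[symmetric])
  have "mat (c j) ** (X - mat (zeta j)) ** ?M ** Pr m = mat (c j) ** ((X - mat (zeta j)) ** (?M ** Pr m))"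
    by (simp only: matrix_mul_assoc)
  also have "\<dots> = mat (c j) ** ((X - mat (zeta j)) ** (mat ?p ** Pr m))"
    by (simp only: Cons.IH)
  also have "\<dots> = mat (c j) ** (mat ?p ** (mat (zeta m - zeta j) ** Pr m))"
    by (simp only: matrix_mult_mat_left_commute[of "X - mat (zeta j)"] XPm)
  also have "\<dots> = mat (c j * (zeta m - zeta j) * ?p) ** Pr m"
    by (simp add: matrix_mul_assoc mat_mult_mat mult_ac)
  finally show ?case by simp
qed simp

lemma lagrange_projector_eq:
  assumes i: "i < r"
  shows "lagrange_projector r zeta i X = Pr i"
proof -
  define js where "js = [j \<leftarrow> [0..<r]. j \<noteq> i]"
  define p where "p m = (\<Prod>j\<leftarrow>js. inverse (zeta i - zeta j) * (zeta m - zeta j))" for m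
  have p: "p m = (if m = i then 1 else 0)" if m: "m < r" for m
  proof (cases "m = i")
    case True
    have "zeta i - zeta j \<noteq> 0" if "j \<in> set js" for j
      using zeta_inj i that by (auto simp: js_def inj_on_def)
    then have "\<forall>j\<in>set js. inverse (zeta i - zeta j) * (zeta m - zeta j) = 1" using True by simp
    then show ?thesis using True unfolding p_def by (induction js) auto
  next
    case False
    then show ?thesis using m by (force simp: p_def js_def prod_list_zero_iff)
  qed
  have "lagrange_projector r zeta i X = (\<Sum>m<r. lagrange_projector r zeta i X ** Pr m)"
    by (simp add: matrix_sum_ldistrib[symmetric] sum_proj)
  also have "\<dots> = (\<Sum>m<r. mat (p m) ** Pr m)"
    by (simp add: lagrange_projector_def foldr_mult_proj p_def js_def)
  also have "\<dots> = (\<Sum>m<r. if m = i then Pr i else 0)"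
    by (rule sum.cong) (simp_all add: p)
  also have "\<dots> = Pr i" using i by simp
  finally show ?thesis .
qed

lemma lagrange_projector_conjugate:
  fixes g :: "complex^'n^'n"
  assumes "invertible g" "i < r"
  shows "lagrange_projector r zeta i (g ** X ** matrix_inv g) = g ** Pr i ** matrix_inv g"
  using spectral_decomposition.lagrange_projector_eq[OF conjugate[OF assms(1)] assms(2)] .

end

lemma eigenspace_conjugate:
  fixes g :: "complex^'n^'n"
  assumes g: "invertible g"
  shows "eigenspace (g ** A ** matrix_inv g) c = (*v) g ` eigenspace A c"
proof (intro set_eqI iffI)
  fix x assume "x \<in> eigenspace (g ** A ** matrix_inv g) c"
  then have "g *v (A *v (matrix_inv g *v x)) = c *s x"
    by (simp add: eigenspace_def matrix_vector_mul_assoc matrix_mul_assoc)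
  then have "A *v (matrix_inv g *v x) = c *s (matrix_inv g *v x)"
    by (metis g matrix_inv_vector_left vector_scalar_commute)
  moreover have "x = g *v (matrix_inv g *v x)"
    using g by (simp add: matrix_inv_vector_right)
  ultimately show "x \<in> (*v) g ` eigenspace A c" by (auto simp: eigenspace_def)
next
  fix x assume "x \<in> (*v) g ` eigenspace A c"
  then obtain w where "A *v w = c *s w" "x = g *v w" by (auto simp: eigenspace_def)
  then show "x \<in> eigenspace (g ** A ** matrix_inv g) c"
    using g by (simp add: eigenspace_def matrix_vector_mul_assoc[symmetric] matrix_inv_vector_left
        vector_scalar_commute)
qed

lemma eigenvalues_conjugate:
  fixes g :: "complex^'n^'n"
  assumes g: "invertible g"
  shows "eigenvalues (g ** A ** matrix_inv g) = eigenvalues A"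
proof -
  have "eigenvalues B = {c. eigenspace B c \<noteq> {0}}" for B :: "complex^'n^'n"
    by (auto simp: eigenvalues_def eigenspace_def)
  moreover have "(*v) g ` S = {0} \<longleftrightarrow> S = {0}" for S
    using inj_image_eq_iff[OF inj_matrix_vector_mult[OF g], of S "{0}"] by simp
  ultimately show ?thesis by (simp add: eigenspace_conjugate[OF g])
qed

definition diag_matrix :: "('n::finite \<Rightarrow> 'a::zero) \<Rightarrow> 'a^'n^'n" where
  "diag_matrix f = (\<chi> a b. if a = b then f a else 0)"

lemma diag_matrix_mult:
  "diag_matrix f ** diag_matrix g = diag_matrix (\<lambda>a. f a * g a :: 'a::semiring_1)"
proof -
  have "(\<Sum>k\<in>UNIV. (if a = k then f a else 0) * (if k = b then g k else 0)) =
      (\<Sum>k\<in>UNIV. if k = a then (if a = b then f a * g a else 0) else 0)" for a b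
    by (rule sum.cong) auto
  then show ?thesis by (simp add: diag_matrix_def matrix_matrix_mult_def vec_eq_iff)
qed

lemma mat_eq_diag_matrix: "mat c = diag_matrix (\<lambda>_. c)"
  by (simp add: mat_def diag_matrix_def)

lemma sum_diag_matrix: "(\<Sum>i\<in>I. diag_matrix (f i)) = diag_matrix (\<lambda>a. \<Sum>i\<in>I. f i a)"
  by (simp add: diag_matrix_def vec_eq_iff if_distrib cong: if_cong)

lemma diag_matrix_eq_iff: "diag_matrix f = diag_matrix g \<longleftrightarrow> f = g"
  by (auto simp: diag_matrix_def vec_eq_iff fun_eq_iff)

lemma diag_matrix_0: "diag_matrix (\<lambda>_. 0) = 0"
  by (simp add: diag_matrix_def vec_eq_iff)

lemma diagonal_spectral_decomposition:
  fixes d :: "'n::finite \<Rightarrow> complex"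
  assumes inj: "inj_on zeta {..<r}" and d: "\<And>a. d a \<in> zeta ` {..<r}"
  shows "spectral_decomposition (diag_matrix d) r zeta
    (\<lambda>i. diag_matrix (\<lambda>a. if d a = zeta i then 1 else 0))"
proof
  have unique: "i = j" if "i < r" "j < r" "d a = zeta i" "d a = zeta j" for i j a
    using inj that by (auto simp: inj_on_def)
  have sum_indicator: "(\<Sum>i<r. if d a = zeta i then 1 else 0) = (1::complex)" for a
  proof -
    obtain i0 where i0: "i0 < r" "d a = zeta i0" using d by blast
    then have "(\<Sum>i<r. if d a = zeta i then 1 else 0) = (\<Sum>i<r. if i = i0 then 1 else (0::complex))"
      using unique by (intro sum.cong) auto
    then show ?thesis using i0 by simp
  qed
  show "(\<Sum>i<r. diag_matrix (\<lambda>a. if d a = zeta i then 1 else 0)) = (mat 1 :: complex^'n^'n)"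
    by (simp add: sum_diag_matrix mat_eq_diag_matrix sum_indicator)
  show "diag_matrix (\<lambda>a. if d a = zeta i then 1 else 0) ** diag_matrix (\<lambda>a. if d a = zeta j then 1 else 0) =
      (if i = j then diag_matrix (\<lambda>a. if d a = zeta i then 1 else 0) else 0)" if "i < r" "j < r" for i j
    using that unique by (auto simp: diag_matrix_mult diag_matrix_0[symmetric] diag_matrix_eq_iff fun_eq_iff)
  show "diag_matrix d ** diag_matrix (\<lambda>a. if d a = zeta i then 1 else 0) =
      mat (zeta i) ** diag_matrix (\<lambda>a. if d a = zeta i then 1 else 0)"
    and "diag_matrix (\<lambda>a. if d a = zeta i then 1 else 0) ** diag_matrix d =
      mat (zeta i) ** diag_matrix (\<lambda>a. if d a = zeta i then 1 else 0)" for i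
    by (simp_all add: mat_eq_diag_matrix diag_matrix_mult diag_matrix_eq_iff fun_eq_iff)
qed (rule inj)

lemma diagonalizable_imp_diag_matrix:
  fixes X :: "complex^'n^'n"
  assumes "diagonalizable X"
  obtains T :: "complex^'n^'n" and d where "invertible T" "T ** X ** matrix_inv T = diag_matrix d"
proof -
  obtain T :: "complex^'n^'n" where T: "invertible T" "\<forall>i j. i \<noteq> j \<longrightarrow> (T ** X ** matrix_inv T) $ i $ j = 0"
    using assms unfolding diagonalizable_def by blast
  then have "T ** X ** matrix_inv T = diag_matrix (\<lambda>a. (T ** X ** matrix_inv T) $ a $ a)"
    by (auto simp: diag_matrix_def vec_eq_iff)
  with T(1) show thesis by (rule that)
qed

lemma diag_entry_eigenvalue: "d a \<in> eigenvalues (diag_matrix d :: complex^'n^'n)"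
proof -
  have "(\<Sum>j\<in>UNIV. (if b = j then d b else 0) * (if j = a then 1 else 0)) =
      (\<Sum>j\<in>UNIV. if j = a then (if b = a then d a else 0) else (0::complex))" for b
    by (rule sum.cong) auto
  then have "diag_matrix d *v axis a 1 = d a *s axis a (1::complex)"
    by (simp add: diag_matrix_def vec_eq_iff matrix_vector_mult_def axis_def)
  moreover have "axis a (1::complex) \<noteq> 0" by (simp add: axis_eq_0_iff)
  ultimately show ?thesis unfolding eigenvalues_def by blast
qed

lemma diagonalizable_spectral_decomposition:
  fixes X :: "complex^'n^'n"
  assumes "diagonalizable X" and inj: "inj_on zeta {..<r}" and ev: "eigenvalues X \<subseteq> zeta ` {..<r}"
  obtains Pr where "spectral_decomposition X r zeta Pr"
proof -
  obtain T :: "complex^'n^'n" and d where T: "invertible T" and D: "T ** X ** matrix_inv T = diag_matrix d"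
    using diagonalizable_imp_diag_matrix[OF assms(1)] by blast
  have "d a \<in> zeta ` {..<r}" for a
    using diag_entry_eigenvalue[of d a] eigenvalues_conjugate[OF T, of X] ev D by auto
  then interpret D: spectral_decomposition "diag_matrix d" r zeta "\<lambda>i. diag_matrix (\<lambda>a. if d a = zeta i then 1 else 0)"
    by (rule diagonal_spectral_decomposition[OF inj])
  have "matrix_inv T ** (T ** X ** matrix_inv T) ** T = (matrix_inv T ** T) ** X ** (matrix_inv T ** T)"
    by (simp add: matrix_mul_assoc)
  then have "X = matrix_inv T ** diag_matrix d ** matrix_inv (matrix_inv T)"
    using T by (simp add: D matrix_inv_matrix_inv matrix_inv_left)
  with D.conjugate[OF invertible_matrix_inv[OF T]] show thesis by (metis that)
qed

lemma spectral_decomposition_exists: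
  fixes P :: "(complex^'n^'n) set"
  assumes ss: "semisimple_class P r zeta kk" and XP: "X \<in> P"
  obtains Pr where "spectral_decomposition X r zeta Pr" "\<And>i. i < r \<Longrightarrow> rank (Pr i) = kk i"
proof -
  obtain X0 :: "complex^'n^'n" where dX0: "diagonalizable X0"
    and Peq: "P = {g ** X0 ** matrix_inv g | g. invertible g}"
    and inj: "inj_on zeta {..<r}" and evX0: "eigenvalues X0 = zeta ` {..<r}"
    and dims: "\<And>i. i < r \<Longrightarrow> vec.dim (eigenspace X0 (zeta i)) = kk i"
    using ss unfolding semisimple_class_def by blast
  obtain g where g: "invertible g" and X: "X = g ** X0 ** matrix_inv g"
    using XP Peq by blast
  obtain Pr0 where "spectral_decomposition X0 r zeta Pr0"
    using diagonalizable_spectral_decomposition[OF dX0 inj] evX0 by blast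
  then interpret X: spectral_decomposition X r zeta "\<lambda>i. g ** Pr0 i ** matrix_inv g"
    unfolding X by (rule spectral_decomposition.conjugate[OF _ g])
  have "rank (g ** Pr0 i ** matrix_inv g) = kk i" if i: "i < r" for i
  proof -
    have "rank (g ** Pr0 i ** matrix_inv g) = vec.dim (eigenspace X (zeta i))"
      using X.eigenspace_eq_range_proj[OF i] by (simp add: rank_dim_range_gen)
    also have "\<dots> = vec.dim (eigenspace X0 (zeta i))"
      unfolding X eigenspace_conjugate[OF g]
      using inj_matrix_vector_mult[OF g]
      by (intro vec.dim_image_eq[OF matrix_vector_mul_linear_gen]) (simp add: inj_on_def inj_def)
    finally show ?thesis using dims[OF i] by simp
  qed
  with X.spectral_decomposition_axioms show thesis by (rule that)
qed

section \<open>The group action and closed orbits\<close>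

lemma gl_act_simp: "gl_act g (X, Y, F, G) = (g ** X ** matrix_inv g, Y, g ** F, G ** matrix_inv g)"
  by (simp add: gl_act_def)

lemma gl_act_mult:
  fixes a b :: "complex^'k::finite^'k" and q :: "('k, 'l::finite) quad"
  assumes "invertible a" "invertible b"
  shows "gl_act (a ** b) q = gl_act a (gl_act b q)"
  by (cases q) (simp add: gl_act_simp matrix_inv_mult[OF assms] matrix_mul_assoc)

lemma gl_act_mat_1: "gl_act (mat 1) q = q"
  by (cases q) (simp add: gl_act_simp matrix_inv_mat_1)

lemma gl_act_in_orbit: "invertible g \<Longrightarrow> gl_act g q \<in> gl_orbit (q :: ('k::finite, 'l::finite) quad)"
  unfolding gl_orbit_def by blast

text \<open>Since the orbit of a point of \<open>M0\<close> is closed, a point of its closure lies in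
  the orbit itself, where stabilisers are conjugate to the trivial one.\<close>
lemma M0_limit_stabilizer_trivial:
  fixes q :: "('k::finite, 'l::finite) quad"
  assumes M: "q \<in> M0" and h: "\<And>n. invertible (h n)" and lim: "(\<lambda>n. gl_act (h n) q) \<longlonglongrightarrow> q0"
    and g: "invertible g" and fixed: "gl_act g q0 = q0"
  shows "g = mat 1"
proof -
  have "q0 \<in> closure (gl_orbit q)"
    unfolding closure_sequential using lim gl_act_in_orbit[OF h, where q = q]
    by (intro exI[of _ "\<lambda>n. gl_act (h n) q"]) simp
  then have "q0 \<in> gl_orbit q" using M closure_closed unfolding M0_def by blast
  then obtain k where k: "invertible k" "q0 = gl_act k q" unfolding gl_orbit_def by blast
  have ki: "invertible (matrix_inv k)" using invertible_matrix_inv[OF k(1)] .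
  have "gl_act (matrix_inv k ** g ** k) q = gl_act (matrix_inv k) (gl_act g q0)"
    using k g ki by (simp add: gl_act_mult invertible_mult)
  also have "\<dots> = gl_act (matrix_inv k) (gl_act k q)" using fixed k(2) by simp
  also have "\<dots> = q"
    using k ki by (simp add: gl_act_mult[symmetric] matrix_inv_left gl_act_mat_1)
  finally have "matrix_inv k ** g ** k = mat 1"
    using M k g ki unfolding M0_def by (blast intro: invertible_mult)
  then have "k ** (matrix_inv k ** g ** k) ** matrix_inv k = mat 1"
    using k by (simp add: matrix_inv_right)
  then show ?thesis
    using k by (simp add: matrix_mul_assoc matrix_inv_right)
      (simp add: matrix_mul_assoc[symmetric] matrix_inv_right)
qed

lemma closed_gl_orbit_if_recoverable:
  fixes q :: "('k::finite, 'l::finite) quad" and \<phi> \<psi> :: "('k, 'l) quad \<Rightarrow> complex^'k^'k"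
  assumes cont: "\<And>p. isCont \<phi> p" "\<And>p. isCont \<psi> p"
    and recover: "\<And>g. invertible g \<Longrightarrow> \<phi> (gl_act g q) = g"
      "\<And>g. invertible g \<Longrightarrow> \<psi> (gl_act g q) = matrix_inv g"
  shows "closed (gl_orbit q)"
  unfolding closed_sequential_limits
proof (intro allI impI, elim conjE)
  fix x l assume mem: "\<forall>n. x n \<in> gl_orbit q" and lim: "x \<longlonglongrightarrow> l"
  have "\<forall>n. \<exists>g. invertible g \<and> x n = gl_act g q"
    using mem unfolding gl_orbit_def by blast
  then obtain g where g: "\<And>n. invertible (g n)" and x: "\<And>n. x n = gl_act (g n) q"
    by metis
  have lim_g: "g \<longlonglongrightarrow> \<phi> l" and lim_ginv: "(\<lambda>n. matrix_inv (g n)) \<longlonglongrightarrow> \<psi> l"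
    using isCont_tendsto_compose[OF cont(1) lim] isCont_tendsto_compose[OF cont(2) lim]
    by (simp_all add: x recover g)
  have "(\<lambda>n. g n ** matrix_inv (g n)) \<longlonglongrightarrow> \<phi> l ** \<psi> l"
    by (intro tendsto_intros lim_g lim_ginv)
  then have "\<phi> l ** \<psi> l = mat 1"
    by (simp add: matrix_inv_right g LIMSEQ_const_iff)
  then have inv: "invertible (\<phi> l)" "matrix_inv (\<phi> l) = \<psi> l"
    by (rule matrix_inv_unique)+
  obtain X Y F G where q: "q = (X, Y, F, G)" by (cases q)
  have "(\<lambda>n. gl_act (g n) q) \<longlonglongrightarrow> gl_act (\<phi> l) q"
    unfolding q gl_act_simp inv(2)
    by (intro tendsto_Pair tendsto_matrix_mult tendsto_const lim_g lim_ginv)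
  moreover have "(\<lambda>n. gl_act (g n) q) = x" by (rule ext) (rule x[symmetric])
  ultimately have "l = gl_act (\<phi> l) q" using lim LIMSEQ_unique by auto
  then show "l \<in> gl_orbit q" using gl_act_in_orbit[OF inv(1), where q = q] by simp
qed

definition dilation :: "'a::field^'n^'n \<Rightarrow> 'a \<Rightarrow> 'a^'n^'n" where
  "dilation E t = mat 1 + mat (t - 1) ** E"

lemma dilation_mult:
  assumes "E ** E = E"
  shows "dilation E s ** dilation E t = dilation E (s * t)"
proof -
  have "dilation E s ** dilation E t =
      mat 1 + (mat (s - 1) ** E + mat (t - 1) ** E + mat ((s - 1) * (t - 1)) ** (E ** E))"
    by (simp add: dilation_def matrix_add_ldistrib matrix_add_rdistrib mat_matrix_mult_mat_matrix add.assoc)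
  also have "\<dots> = mat 1 + (mat (s - 1) + mat (t - 1) + mat ((s - 1) * (t - 1))) ** E"
    using assms by (simp add: matrix_add_rdistrib)
  also have "mat (s - 1) + mat (t - 1) + mat ((s - 1) * (t - 1)) = (mat (s * t - 1) :: 'a^'n^'n)"
    by (simp add: mat_add_mat algebra_simps)
  finally show ?thesis by (simp add: dilation_def)
qed

lemma dilation_invertible:
  assumes "E ** E = E" "t \<noteq> 0"
  shows "invertible (dilation E t)" "matrix_inv (dilation E t) = dilation E (inverse t)"
proof -
  have "dilation E t ** dilation E (inverse t) = mat 1"
    using assms by (simp add: dilation_mult) (simp add: dilation_def)
  then show "invertible (dilation E t)" "matrix_inv (dilation E t) = dilation E (inverse t)"
    by (rule matrix_inv_unique)+
qed

lemma dilation_conjugate: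
  assumes "E ** E = E" "E ** X = X ** E" "t \<noteq> 0"
  shows "dilation E t ** X ** dilation E (inverse t) = X"
proof -
  have "dilation E t ** X = X ** dilation E t"
    using assms(2) by (simp add: dilation_def matrix_add_ldistrib matrix_add_rdistrib
        matrix_mult_mat_left_commute matrix_mul_assoc[symmetric])
  then have "dilation E t ** X ** dilation E (inverse t) = X ** (dilation E t ** dilation E (inverse t))"
    by (simp add: matrix_mul_assoc)
  then show ?thesis using assms(1,3) by (simp add: dilation_mult) (simp add: dilation_def)
qed

lemma dilation_2: "dilation E 2 = mat 1 + E"
  by (simp add: dilation_def)

lemma dilation_2_eq_1: "dilation E 2 = mat 1 \<Longrightarrow> E = 0"
  by (simp add: dilation_2)

lemma gl_act_dilation:
  assumes "E ** E = E" "E ** X = X ** E" "s \<noteq> 0"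
  shows "gl_act (dilation E s) (X, Y, F, G) = (X, Y, dilation E s ** F, G ** dilation E (inverse s))"
  using assms by (simp add: gl_act_simp dilation_invertible dilation_conjugate)

lemma tendsto_inverse_Suc: "(\<lambda>n. inverse (of_nat (Suc n)) :: complex) \<longlonglongrightarrow> 0"
  using LIMSEQ_Suc[OF lim_inverse_n] .

text \<open>Dilating along \<open>E\<close> fixes \<open>X\<close> and \<open>G\<close> and shrinks \<open>E ** F\<close> to \<open>0\<close>; the limit point of
  the orbit is fixed by the nontrivial dilation \<open>mat 1 + E\<close>.\<close>
lemma M0_idempotent_in_kernel:
  fixes X :: "complex^'k::finite^'k" and G :: "complex^'k^'l::finite"
  assumes M: "(X, Y, F, G) \<in> M0" and E: "E ** E = E" "E ** X = X ** E" and GE: "G ** E = 0"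
  shows "E = 0"
proof -
  define t where "t n = inverse (of_nat (Suc n) :: complex)" for n
  have t: "t n \<noteq> 0" for n unfolding t_def using of_nat_neq_0 by simp
  have G_dilation: "G ** dilation E s = G" for s
    by (simp add: dilation_def matrix_add_ldistrib matrix_mult_mat_left_commute GE)
  have F_dilation: "dilation E s ** F = F + mat (s - 1) ** (E ** F)" for s
    by (simp add: dilation_def matrix_add_rdistrib matrix_mul_assoc)
  have "(\<lambda>n. (X, Y, F + mat (t n - 1) ** (E ** F), G)) \<longlonglongrightarrow> (X, Y, F + mat (0 - 1) ** (E ** F), G)"
    unfolding t_def by (intro tendsto_intros tendsto_inverse_Suc)
  then have lim: "(\<lambda>n. gl_act (dilation E (t n)) (X, Y, F, G)) \<longlonglongrightarrow> (X, Y, F - E ** F, G)"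
    by (simp add: gl_act_dilation[OF E t] F_dilation G_dilation mat_minus_one_mult)
  have "dilation E 2 ** (F - E ** F) = F - E ** F + (E ** F - (E ** E) ** F)"
    unfolding dilation_2 by (simp add: matrix_add_rdistrib matrix_diff_ldistrib matrix_mul_assoc)
  moreover have "(2::complex) \<noteq> 0" by simp
  ultimately have "gl_act (dilation E 2) (X, Y, F - E ** F, G) = (X, Y, F - E ** F, G)"
    using E(1) by (simp add: gl_act_dilation[OF E] G_dilation)
  then have "dilation E 2 = mat 1"
    using M0_limit_stabilizer_trivial[OF M dilation_invertible(1)[OF E(1) t] lim] dilation_invertible(1)[OF E(1)]
    by simp
  then show ?thesis by (rule dilation_2_eq_1)
qed

lemma M0_idempotent_in_cokernel:
  fixes X :: "complex^'k::finite^'k" and F :: "complex^'l::finite^'k"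
  assumes M: "(X, Y, F, G) \<in> M0" and E: "E ** E = E" "E ** X = X ** E" and EF: "E ** F = 0"
  shows "E = 0"
proof -
  define t where "t n = inverse (of_nat (Suc n) :: complex)" for n
  have t: "inverse (t n) \<noteq> 0" for n unfolding t_def using of_nat_neq_0 by simp
  have F_dilation: "dilation E s ** F = F" for s
    by (simp add: dilation_def matrix_add_rdistrib matrix_mul_assoc[symmetric] EF)
  have G_dilation: "G ** dilation E s = G + mat (s - 1) ** (G ** E)" for s
    by (simp add: dilation_def matrix_add_ldistrib matrix_mult_mat_left_commute)
  have "(\<lambda>n. (X, Y, F, G + mat (t n - 1) ** (G ** E))) \<longlonglongrightarrow> (X, Y, F, G + mat (0 - 1) ** (G ** E))"
    unfolding t_def by (intro tendsto_intros tendsto_inverse_Suc)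
  then have lim: "(\<lambda>n. gl_act (dilation E (inverse (t n))) (X, Y, F, G)) \<longlonglongrightarrow> (X, Y, F, G - G ** E)"
    by (simp only: gl_act_dilation[OF E t] F_dilation G_dilation inverse_inverse_eq)
      (simp add: mat_minus_one_mult)
  have "(G - G ** E) ** E = 0"
    using E(1) by (simp add: matrix_diff_rdistrib matrix_mul_assoc[symmetric])
  then have "(G - G ** E) ** dilation E s = G - G ** E" for s
    by (simp add: dilation_def matrix_add_ldistrib matrix_mult_mat_left_commute)
  moreover have "(2::complex) \<noteq> 0" by simp
  ultimately have "gl_act (dilation E 2) (X, Y, F, G - G ** E) = (X, Y, F, G - G ** E)"
    by (simp add: gl_act_dilation[OF E] F_dilation)
  then have "dilation E 2 = mat 1"
    using M0_limit_stabilizer_trivial[OF M dilation_invertible(1)[OF E(1) t] lim] dilation_invertible(1)[OF E(1)]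
    by simp
  then show ?thesis by (rule dilation_2_eq_1)
qed

section \<open>Stable quadruples\<close>

definition outer_product :: "'a::comm_semiring_1^'m \<Rightarrow> 'a^'n \<Rightarrow> 'a^'n^'m" where
  "outer_product v w = (\<chi> a b. v$a * w$b)"

lemma matrix_mult_outer_product: "A ** outer_product v w = outer_product (A *v v) w"
  by (simp add: outer_product_def matrix_matrix_mult_def matrix_vector_mult_def vec_eq_iff
      sum_distrib_left sum_distrib_right mult_ac)

lemma outer_product_mult_matrix: "outer_product v w ** A = outer_product v (w v* A)"
  by (simp add: outer_product_def matrix_matrix_mult_def vector_matrix_mult_def vec_eq_iff
      sum_distrib_left mult_ac)

lemma vector_matrix_mult_outer_product: "u v* outer_product v w = (\<Sum>a\<in>UNIV. u$a * v$a) *s w"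
  by (simp add: outer_product_def vector_matrix_mult_def vec_eq_iff sum_distrib_left sum_distrib_right mult_ac)

lemma outer_product_scale: "outer_product (c *s v) w = outer_product v (c *s w)"
  by (simp add: outer_product_def vec_eq_iff mult_ac)

lemma outer_product_0_left: "outer_product 0 w = 0" and outer_product_0_right: "outer_product v 0 = 0"
  by (simp_all add: outer_product_def vec_eq_iff)

lemma outer_product_idem:
  "(\<Sum>a\<in>UNIV. w$a * v$a) = 1 \<Longrightarrow> outer_product v w ** outer_product v w = outer_product v w"
  by (simp add: outer_product_mult_matrix vector_matrix_mult_outer_product)

lemma outer_product_nonzero:
  fixes v w :: "'a::field^'n"
  assumes "(\<Sum>a\<in>UNIV. w$a * v$a) = 1"
  shows "outer_product v w \<noteq> 0"
proof
  assume "outer_product v w = 0"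
  then have "w v* outer_product v w = 0" by simp
  then show False using assms by (simp add: vector_matrix_mult_outer_product)
qed

lemma pairing_vector_matrix_mult:
  "(\<Sum>a\<in>UNIV. (u v* A)$a * v$a) = (\<Sum>a\<in>UNIV. u$a * (A *v v)$a)"
proof -
  have "(\<Sum>a\<in>UNIV. (u v* A)$a * v$a) = (\<Sum>a\<in>UNIV. \<Sum>i\<in>UNIV. u$i * A$i$a * v$a)"
    by (simp add: vector_matrix_mult_def sum_distrib_right)
  also have "\<dots> = (\<Sum>i\<in>UNIV. \<Sum>a\<in>UNIV. u$i * A$i$a * v$a)" by (rule sum.swap)
  also have "\<dots> = (\<Sum>i\<in>UNIV. u$i * (A *v v)$i)"
    by (simp add: matrix_vector_mult_def sum_distrib_left mult.assoc)
  finally show ?thesis .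
qed

lemma pairing_axis_left: "(\<Sum>b\<in>UNIV. axis a c $ b * (v::'a::semiring_1^'n)$b) = c * v$a"
proof -
  have "(\<Sum>b\<in>UNIV. axis a c $ b * v$b) = (\<Sum>b\<in>UNIV. if b = a then c * v$a else 0)"
    by (rule sum.cong) (auto simp: axis_def)
  then show ?thesis by simp
qed

lemma pairing_axis_right: "(\<Sum>b\<in>UNIV. (u::'a::semiring_1^'n)$b * axis a c $ b) = u$a * c"
proof -
  have "(\<Sum>b\<in>UNIV. u$b * axis a c $ b) = (\<Sum>b\<in>UNIV. if b = a then u$a * c else 0)"
    by (rule sum.cong) (auto simp: axis_def)
  then show ?thesis by simp
qed

text \<open>\<open>G\<close> is injective on each eigenspace \<open>range (Pr i)\<close> and \<open>Pr i ** F\<close> maps onto it,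
  expressed through one-sided inverses.\<close>
definition spectrally_stable ::
  "nat \<Rightarrow> (nat \<Rightarrow> complex^'k^'k) \<Rightarrow> complex^'l^'k \<Rightarrow> complex^'k^'l \<Rightarrow> bool" where
  "spectrally_stable r Pr F G \<longleftrightarrow>
     (\<forall>i<r. (\<exists>M. Pr i ** F ** M = Pr i) \<and> (\<exists>N. N ** G ** Pr i = Pr i))"

lemma spectrally_stableE:
  assumes "spectrally_stable r Pr F G"
  obtains M N where "\<And>i. i < r \<Longrightarrow> Pr i ** F ** M i = Pr i" "\<And>i. i < r \<Longrightarrow> N i ** G ** Pr i = Pr i"
proof -
  have "\<forall>i. \<exists>M N. i < r \<longrightarrow> Pr i ** F ** M = Pr i \<and> N ** G ** Pr i = Pr i"
    using assms unfolding spectrally_stable_def by blast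
  then obtain M N where "\<forall>i. i < r \<longrightarrow> Pr i ** F ** M i = Pr i \<and> N i ** G ** Pr i = Pr i"
    by metis
  then show thesis using that by blast
qed

context spectral_decomposition
begin

lemma M0_kernel_meets_eigenspace_trivially:
  fixes G :: "complex^'n^'l::finite"
  assumes M: "(X, Y, F, G) \<in> M0" and i: "i < r" and v: "Pr i *v v = v" and Gv: "G *v v = 0"
  shows "v = 0"
proof (rule ccontr)
  assume "v \<noteq> 0"
  then obtain a where a: "v $ a \<noteq> 0" by (auto simp: vec_eq_iff)
  define w where "w = axis a (inverse (v$a)) v* Pr i"
  have pairing: "(\<Sum>b\<in>UNIV. w$b * v$b) = 1"
    using a by (simp add: w_def pairing_vector_matrix_mult v pairing_axis_left)
  have "X *v v = zeta i *s v"
    using v X_mult_proj[OF i] by (metis matrix_vector_mul_assoc mat_matrix_vector_mult)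
  moreover have "w v* X = zeta i *s w"
    unfolding w_def vector_matrix_mul_assoc proj_mult_X[OF i] by (rule vector_matrix_mult_mat)
  ultimately have "outer_product v w ** X = X ** outer_product v w"
    by (simp add: matrix_mult_outer_product outer_product_mult_matrix outer_product_scale)
  moreover have "G ** outer_product v w = 0"
    by (simp add: matrix_mult_outer_product Gv outer_product_0_left)
  ultimately have "outer_product v w = 0"
    by (rule M0_idempotent_in_kernel[OF M outer_product_idem[OF pairing]])
  then show False using outer_product_nonzero[OF pairing] by simp
qed

lemma M0_cokernel_meets_eigenspace_trivially:
  fixes F :: "complex^'l::finite^'n"
  assumes M: "(X, Y, F, G) \<in> M0" and i: "i < r" and u: "u v* Pr i = u" and uF: "u v* F = 0"
  shows "u = 0"
proof (rule ccontr)
  assume "u \<noteq> 0"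
  then obtain a where a: "u $ a \<noteq> 0" by (auto simp: vec_eq_iff)
  define v where "v = Pr i *v axis a (inverse (u$a))"
  have pairing: "(\<Sum>b\<in>UNIV. u$b * v$b) = 1"
    using a by (simp add: v_def pairing_vector_matrix_mult[symmetric] u pairing_axis_right)
  have "X *v v = zeta i *s v"
    unfolding v_def matrix_vector_mul_assoc X_mult_proj[OF i] by (rule mat_matrix_vector_mult)
  moreover have "u v* X = zeta i *s u"
    using u proj_mult_X[OF i] by (metis vector_matrix_mul_assoc vector_matrix_mult_mat)
  ultimately have "outer_product v u ** X = X ** outer_product v u"
    by (simp add: matrix_mult_outer_product outer_product_mult_matrix outer_product_scale)
  moreover have "outer_product v u ** F = 0"
    by (simp add: outer_product_mult_matrix uF outer_product_0_right)
  ultimately have "outer_product v u = 0"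
    by (rule M0_idempotent_in_cokernel[OF M outer_product_idem[OF pairing]])
  then show False using outer_product_nonzero[OF pairing] by simp
qed

lemma M0_imp_spectrally_stable:
  assumes "(X, Y, F, G) \<in> M0"
  shows "spectrally_stable r Pr F G"
  unfolding spectrally_stable_def
proof (intro allI impI conjI)
  fix i assume i: "i < r"
  show "\<exists>M. Pr i ** F ** M = Pr i"
    using exists_right_inverse_on_range[OF proj_idem[OF i]]
      M0_cokernel_meets_eigenspace_trivially[OF assms i] by blast
  show "\<exists>N. N ** G ** Pr i = Pr i"
    using exists_left_inverse_on_range[OF proj_idem[OF i]]
      M0_kernel_meets_eigenspace_trivially[OF assms i] by blast
qed

lemma spectrally_stable_stabilizer_trivial:
  assumes "spectrally_stable r Pr F G" and g: "invertible g"
    and fixed: "gl_act g (X, Y, F, G) = (X, Y, F, G)"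
  shows "g = mat 1"
proof (rule matrix_eq_by_proj_right)
  fix i assume i: "i < r"
  obtain M where M: "Pr i ** F ** M = Pr i"
    using assms(1) i unfolding spectrally_stable_def by blast
  have gXg: "g ** X ** matrix_inv g = X" and gF: "g ** F = F"
    using fixed by (simp_all add: gl_act_simp)
  have "g ** X = g ** X ** matrix_inv g ** g"
    using g by (simp add: matrix_mul_assoc[symmetric] matrix_inv_left)
  then have "g ** X = X ** g" by (simp add: gXg)
  then have "g ** Pr i = Pr i ** g ** F ** M"
    using commute_proj[OF _ i, of g] M by (metis matrix_mul_assoc)
  then show "g ** Pr i = mat 1 ** Pr i"
    using M by (simp add: gF matrix_mul_assoc[symmetric])
qed

lemma spectrally_stable_closed_orbit:
  fixes F :: "complex^'l::finite^'n"
  assumes "spectrally_stable r Pr F G"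
  shows "closed (gl_orbit (X, Y, F, G))"
proof -
  obtain M N where M: "\<And>i. i < r \<Longrightarrow> Pr i ** F ** M i = Pr i"
    and N: "\<And>i. i < r \<Longrightarrow> N i ** G ** Pr i = Pr i"
    using spectrally_stableE[OF assms] by blast
  let ?\<phi> = "\<lambda>(X', Y', F', G'). \<Sum>i<r. lagrange_projector r zeta i X' ** F' ** M i"
  let ?\<psi> = "\<lambda>(X', Y', F', G'). \<Sum>i<r. N i ** G' ** lagrange_projector r zeta i X'"
  show ?thesis
  proof (rule closed_gl_orbit_if_recoverable)
    show "?\<phi> (gl_act g (X, Y, F, G)) = g" if g: "invertible g" for g
    proof -
      have "lagrange_projector r zeta i (g ** X ** matrix_inv g) ** (g ** F) ** M i = g ** Pr i" if "i < r" for i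
        unfolding lagrange_projector_conjugate[OF g that] using g M[OF that]
        by (simp add: matrix_mul_assoc[symmetric]) (simp add: matrix_mul_assoc matrix_inv_left)
      then show ?thesis
        by (simp add: gl_act_simp matrix_sum_ldistrib[symmetric] sum_proj)
    qed
    show "?\<psi> (gl_act g (X, Y, F, G)) = matrix_inv g" if g: "invertible g" for g
    proof -
      have "N i ** (G ** matrix_inv g) ** lagrange_projector r zeta i (g ** X ** matrix_inv g) = Pr i ** matrix_inv g"
        if "i < r" for i
        unfolding lagrange_projector_conjugate[OF g that] using g N[OF that]
        by (simp add: matrix_mul_assoc[symmetric]) (simp add: matrix_mul_assoc matrix_inv_left)
      then show ?thesis
        by (simp add: gl_act_simp matrix_sum_rdistrib[symmetric] sum_proj)
    qed
    show "isCont ?\<phi> p" "isCont ?\<psi> p" for p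
      unfolding isCont_def case_prod_beta
      by (intro tendsto_sum tendsto_matrix_mult tendsto_lagrange_projector tendsto_const
          tendsto_fst tendsto_snd tendsto_ident_at)+
  qed
qed

lemma spectrally_stable_imp_M0:
  fixes F :: "complex^'l::finite^'n"
  assumes "spectrally_stable r Pr F G"
  shows "(X, Y, F, G) \<in> M0"
  using spectrally_stable_stabilizer_trivial[OF assms] spectrally_stable_closed_orbit[OF assms]
  unfolding M0_def by blast

lemma rank_residue:
  assumes "spectrally_stable r Pr F G" and i: "i < r"
  shows "rank (G ** Pr i ** F) = rank (Pr i)"
proof -
  obtain M N where M: "Pr i ** F ** M i = Pr i" and N: "N i ** G ** Pr i = Pr i"
    using spectrally_stableE[OF assms(1)] i by metis
  have "N i ** (G ** Pr i ** F) ** M i = (N i ** G ** Pr i) ** (Pr i ** F ** M i)"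
    using proj_idem[OF i] by (metis matrix_mul_assoc)
  then have "Pr i = N i ** (G ** Pr i ** F) ** M i" by (simp add: M N proj_idem[OF i])
  then have "rank (Pr i) \<le> rank (G ** Pr i ** F)"
    by (metis order_trans rank_matrix_mult_le_left rank_matrix_mult_le_right)
  moreover have "rank (G ** Pr i ** F) \<le> rank (Pr i)"
    by (metis order_trans rank_matrix_mult_le_left rank_matrix_mult_le_right)
  ultimately show ?thesis by simp
qed

lemma realize_residues:
  fixes R :: "nat \<Rightarrow> complex^'l::finite^'l"
  assumes rank: "\<And>i. i < r \<Longrightarrow> rank (R i) = rank (Pr i)"
  obtains F G where "spectrally_stable r Pr F G" "\<And>i. i < r \<Longrightarrow> G ** Pr i ** F = R i"
proof -
  have "\<forall>i. \<exists>A B M N. i < r \<longrightarrow> R i = A ** Pr i ** B \<and> Pr i ** B ** M = Pr i \<and> N ** A ** Pr i = Pr i"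
    using exists_factorization_through_idempotent[OF proj_idem rank] by blast
  then obtain A B M N where fac: "\<And>i. i < r \<Longrightarrow>
      R i = A i ** Pr i ** B i \<and> Pr i ** B i ** M i = Pr i \<and> N i ** A i ** Pr i = Pr i"
    by metis
  define F where "F = (\<Sum>j<r. Pr j ** B j)"
  define G where "G = (\<Sum>j<r. A j ** Pr j)"
  have PF: "Pr i ** F = Pr i ** B i" if "i < r" for i
    unfolding F_def by (rule proj_mult_sum[OF that])
  have GP: "G ** Pr i = A i ** Pr i" if "i < r" for i
    unfolding G_def by (rule sum_mult_proj[OF that])
  have "spectrally_stable r Pr F G"
    unfolding spectrally_stable_def using fac by (metis PF GP matrix_mul_assoc)
  moreover have "G ** Pr i ** F = R i" if i: "i < r" for i
  proof -
    have "G ** Pr i ** F = (G ** Pr i) ** (Pr i ** F)"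
      using proj_idem[OF i] by (metis matrix_mul_assoc)
    also have "\<dots> = A i ** (Pr i ** Pr i) ** B i"
      by (simp add: PF[OF i] GP[OF i] matrix_mul_assoc)
    finally show ?thesis using fac[OF i] by (simp add: proj_idem[OF i])
  qed
  ultimately show thesis by (rule that)
qed

end

section \<open>Transfer maps\<close>

context spectral_decomposition
begin

lemma transfer_map_gl_act:
  fixes g :: "complex^'n^'n"
  assumes g: "invertible g"
  shows "transfer_map r zeta (gl_act g (X, Y, F, G)) = transfer_map r zeta (X, Y, F, G)"
proof -
  have residue: "G ** matrix_inv g ** (g ** Pr i ** matrix_inv g) ** (g ** F) = G ** Pr i ** F" for i
  proof -
    have "G ** matrix_inv g ** (g ** Pr i ** matrix_inv g) ** (g ** F) =
        G ** (matrix_inv g ** g) ** Pr i ** (matrix_inv g ** g) ** F"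
      by (simp add: matrix_mul_assoc)
    then show ?thesis using g by (simp add: matrix_inv_left)
  qed
  show ?thesis
    unfolding gl_act_simp spectral_decomposition.transfer_map_eq[OF conjugate[OF g]] transfer_map_eq residue ..
qed

end

lemma residue_intertwine:
  assumes "P ** P = P" "P ** F ** M = P" "G' ** P' ** F' = G ** P ** F"
  shows "G' ** (P' ** F' ** M ** P) = G ** P"
proof -
  have "G' ** (P' ** F' ** M ** P) = G ** P ** F ** M ** P"
    using assms(3) by (simp add: matrix_mul_assoc)
  also have "\<dots> = G ** P"
    using assms(1,2) by (simp add: matrix_mul_assoc[symmetric])
  finally show ?thesis .
qed

text \<open>Blockwise, \<open>h\<close> maps \<open>range (Pr i)\<close> into \<open>range (Pr' i)\<close>. As \<open>G'\<close> is injective on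
  \<open>range (Pr' i)\<close> (it has the left inverse \<open>N' i\<close>), the equal residues force the identities
  below.\<close>
lemma intertwiner:
  assumes sd: "spectral_decomposition X r zeta Pr" and sd': "spectral_decomposition X' r zeta Pr'"
    and M: "\<And>i. i < r \<Longrightarrow> Pr i ** F ** M i = Pr i"
    and N': "\<And>i. i < r \<Longrightarrow> N' i ** G' ** Pr' i = Pr' i"
    and R: "\<And>i. i < r \<Longrightarrow> G' ** Pr' i ** F' = G ** Pr i ** F"
  defines "h \<equiv> \<Sum>j<r. Pr' j ** F' ** M j ** Pr j"
  shows "G' ** h = G" "h ** F = F'" "X' ** h = h ** X"
proof -
  interpret A: spectral_decomposition X r zeta Pr by (rule sd)
  interpret B: spectral_decomposition X' r zeta Pr' by (rule sd')
  have hP: "h ** Pr i = Pr' i ** F' ** M i ** Pr i" if "i < r" for i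
    unfolding h_def using A.sum_mult_proj[OF that, of "\<lambda>j. Pr' j ** F' ** M j"] .
  have res: "G' ** (Pr' i ** F' ** M i ** Pr i) = G ** Pr i" if "i < r" for i
    by (rule residue_intertwine[OF A.proj_idem[OF that] M[OF that] R[OF that]])
  show "G' ** h = G"
  proof (rule A.matrix_eq_by_proj_right)
    fix i assume i: "i < r"
    have "G' ** h ** Pr i = G' ** (h ** Pr i)" by (simp only: matrix_mul_assoc)
    then show "G' ** h ** Pr i = G ** Pr i" by (simp only: hP[OF i] res[OF i])
  qed
  show "h ** F = F'"
  proof (rule B.matrix_eq_by_proj_left)
    fix i assume i: "i < r"
    have "Pr' i ** (h ** F) = Pr' i ** F' ** M i ** Pr i ** F"
      using B.proj_mult_sum[OF i, of "\<lambda>j. F' ** M j ** Pr j"] unfolding h_def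
      by (simp add: matrix_mul_assoc)
    also have "\<dots> = Pr' i ** F'"
    proof (rule cancel_by_left_inverse[OF N'[OF i]])
      show "Pr' i ** (Pr' i ** F' ** M i ** Pr i ** F) = Pr' i ** F' ** M i ** Pr i ** F"
        "Pr' i ** (Pr' i ** F') = Pr' i ** F'"
        using B.proj_idem[OF i] by (simp_all add: matrix_mul_assoc)
      show "G' ** (Pr' i ** F' ** M i ** Pr i ** F) = G' ** (Pr' i ** F')"
        using res[OF i] R[OF i] by (simp add: matrix_mul_assoc)
    qed
    finally show "Pr' i ** (h ** F) = Pr' i ** F'" .
  qed
  show "X' ** h = h ** X"
  proof (rule A.matrix_eq_by_proj_right)
    fix i assume i: "i < r"
    have "X' ** h ** Pr i = X' ** Pr' i ** (F' ** M i ** Pr i)"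
      using hP[OF i] by (simp add: matrix_mul_assoc[symmetric])
    also have "\<dots> = mat (zeta i) ** (h ** Pr i)"
      using hP[OF i] B.X_mult_proj[OF i] by (simp add: matrix_mul_assoc)
    also have "\<dots> = h ** X ** Pr i"
      using A.X_mult_proj[OF i] by (simp add: matrix_mul_assoc[symmetric] matrix_mult_mat_left_commute)
    finally show "X' ** h ** Pr i = h ** X ** Pr i" .
  qed
qed

lemma intertwiner_left_inverse:
  assumes sd: "spectral_decomposition X r zeta Pr" and sd': "spectral_decomposition X' r zeta Pr'"
    and M: "\<And>i. i < r \<Longrightarrow> Pr i ** F ** M i = Pr i"
    and N: "\<And>i. i < r \<Longrightarrow> N i ** G ** Pr i = Pr i"
    and M': "\<And>i. i < r \<Longrightarrow> Pr' i ** F' ** M' i = Pr' i"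
    and R: "\<And>i. i < r \<Longrightarrow> G' ** Pr' i ** F' = G ** Pr i ** F"
  shows "(\<Sum>j<r. Pr j ** F ** M' j ** Pr' j) ** (\<Sum>j<r. Pr' j ** F' ** M j ** Pr j) = mat 1"
    (is "?h' ** ?h = _")
proof -
  interpret A: spectral_decomposition X r zeta Pr by (rule sd)
  interpret B: spectral_decomposition X' r zeta Pr' by (rule sd')
  show ?thesis
  proof (rule A.matrix_eq_by_proj_right)
    fix i assume i: "i < r"
    let ?Z = "(Pr i ** F ** M' i ** Pr' i) ** (Pr' i ** F' ** M i ** Pr i)"
    have hP: "?h ** Pr i = Pr' i ** F' ** M i ** Pr i"
      using A.sum_mult_proj[OF i, of "\<lambda>j. Pr' j ** F' ** M j"] .
    have h'P: "?h' ** Pr' i = Pr i ** F ** M' i ** Pr' i"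
      using B.sum_mult_proj[OF i, of "\<lambda>j. Pr j ** F ** M' j"] .
    have idem: "Pr' i ** F' ** M i ** Pr i = Pr' i ** (Pr' i ** F' ** M i ** Pr i)"
      using B.proj_idem[OF i] by (simp add: matrix_mul_assoc)
    have "?h' ** ?h ** Pr i = ?h' ** (?h ** Pr i)" by (simp only: matrix_mul_assoc)
    also have "\<dots> = ?h' ** (Pr' i ** (Pr' i ** F' ** M i ** Pr i))" by (simp only: hP idem[symmetric])
    also have "\<dots> = ?h' ** Pr' i ** (Pr' i ** F' ** M i ** Pr i)" by (simp only: matrix_mul_assoc)
    also have "\<dots> = ?Z" by (simp only: h'P)
    also have "?Z = Pr i"
    proof (rule cancel_by_left_inverse[OF N[OF i]])
      show "Pr i ** ?Z = ?Z" "Pr i ** Pr i = Pr i"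
        using A.proj_idem[OF i] by (simp_all add: matrix_mul_assoc)
      have "G ** ?Z = G' ** Pr' i ** (Pr' i ** F' ** M i ** Pr i)"
        using residue_intertwine[OF B.proj_idem[OF i] M'[OF i] R[OF i, symmetric]]
        by (simp add: matrix_mul_assoc)
      also have "\<dots> = G' ** (Pr' i ** (Pr' i ** F' ** M i ** Pr i))" by (simp only: matrix_mul_assoc)
      also have "Pr' i ** (Pr' i ** F' ** M i ** Pr i) = Pr' i ** F' ** M i ** Pr i"
        using B.proj_idem[OF i] by (simp add: matrix_mul_assoc)
      finally show "G ** ?Z = G ** Pr i"
        using residue_intertwine[OF A.proj_idem[OF i] M[OF i] R[OF i]] by simp
    qed
    finally show "?h' ** ?h ** Pr i = mat 1 ** Pr i" by simp
  qed
qed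

lemma equal_residues_imp_same_orbit:
  fixes X :: "complex^'k::finite^'k" and F :: "complex^'l::finite^'k"
  assumes sd: "spectral_decomposition X r zeta Pr" and sd': "spectral_decomposition X' r zeta Pr'"
    and st: "spectrally_stable r Pr F G" and st': "spectrally_stable r Pr' F' G'"
    and R: "\<And>i. i < r \<Longrightarrow> G' ** Pr' i ** F' = G ** Pr i ** F"
  shows "(X', Y, F', G') \<in> gl_orbit (X, Y, F, G)"
proof -
  obtain M where M: "\<And>i. i < r \<Longrightarrow> Pr i ** F ** M i = Pr i"
    using spectrally_stableE[OF st] by metis
  obtain M' N' where M': "\<And>i. i < r \<Longrightarrow> Pr' i ** F' ** M' i = Pr' i"
    and N': "\<And>i. i < r \<Longrightarrow> N' i ** G' ** Pr' i = Pr' i"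
    using spectrally_stableE[OF st'] by blast
  define h where "h = (\<Sum>j<r. Pr' j ** F' ** M j ** Pr j)"
  define h' where "h' = (\<Sum>j<r. Pr j ** F ** M' j ** Pr' j)"
  note fwd = intertwiner[OF sd sd' M N' R, folded h_def]
  have "h ** h' = mat 1"
    using intertwiner_left_inverse[OF sd' sd M' N' M R[symmetric]] unfolding h_def h'_def .
  then have inv: "invertible h" "matrix_inv h = h'" by (rule matrix_inv_unique)+
  have "X' = X' ** h ** h'" "G' = G' ** h ** h'"
    using \<open>h ** h' = mat 1\<close> by (simp_all add: matrix_mul_assoc[symmetric])
  then have "X' = h ** X ** h'" "G' = G ** h'" by (simp_all only: fwd(1,3))
  then have "gl_act h (X, Y, F, G) = (X', Y, F', G')"
    by (simp add: gl_act_simp inv(2) fwd(2))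
  then show ?thesis using gl_act_in_orbit[OF inv(1), of "(X, Y, F, G)"] by simp
qed

lemma partial_fractions_unique_scalar:
  fixes zeta a :: "nat \<Rightarrow> complex"
  assumes inj: "inj_on zeta {..<r}"
    and zero: "\<And>z. z \<notin> zeta ` {..<r} \<Longrightarrow> d + (\<Sum>i<r. a i * inverse (z - zeta i)) = 0"
  shows "d = 0" and "\<And>j. j < r \<Longrightarrow> a j = 0"
proof -
  show a0: "a j = 0" if j: "j < r" for j
  proof -
    text \<open>Multiplying by \<open>z - \<zeta>\<^sub>j\<close> leaves a function continuous at \<open>\<zeta>\<^sub>j\<close> with value \<open>a j\<close>.\<close>
    define f where "f z = (z - zeta j) * d + a j + (\<Sum>i\<in>{..<r} - {j}. a i * ((z - zeta j) * inverse (z - zeta i)))" for z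
    have "zeta j - zeta i \<noteq> 0" if "i \<in> {..<r} - {j}" for i
      using inj j that by (auto simp: inj_on_def)
    then have lim: "(f \<longlongrightarrow> f (zeta j)) (at (zeta j))"
      unfolding f_def by (intro tendsto_intros) auto
    have "eventually (\<lambda>z. \<forall>y\<in>zeta ` {..<r}. z \<noteq> y) (at (zeta j))"
      by (rule eventually_ball_finite) (auto intro: eventually_neq_at_within)
    then have "eventually (\<lambda>z. f z = 0) (at (zeta j))"
    proof (rule eventually_mono)
      fix z assume "\<forall>y\<in>zeta ` {..<r}. z \<noteq> y"
      then have z: "z \<notin> zeta ` {..<r}" and zj: "z - zeta j \<noteq> 0" using j by auto
      have "0 = (z - zeta j) * (d + a j * inverse (z - zeta j) + (\<Sum>i\<in>{..<r} - {j}. a i * inverse (z - zeta i)))"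
        using zero[OF z] j by (simp add: sum.remove[of "{..<r}" j] add.assoc)
      also have "\<dots> = f z" using zj by (simp add: f_def distrib_left sum_distrib_left mult_ac)
      finally show "f z = 0" by simp
    qed
    then have "(f \<longlongrightarrow> 0) (at (zeta j))" by (rule tendsto_eventually)
    with lim have "f (zeta j) = 0" using tendsto_unique[OF at_neq_bot] by blast
    then show ?thesis by (simp add: f_def)
  qed
  obtain z :: complex where "z \<notin> zeta ` {..<r}"
    using ex_new_if_finite[OF infinite_UNIV_char_0] by blast
  then show "d = 0" using zero a0 by simp
qed

lemma partial_fractions_unique:
  fixes zeta :: "nat \<Rightarrow> complex" and Y Y' :: "complex^'l^'l"
  assumes inj: "inj_on zeta {..<r}"
    and eq: "\<And>z. z \<notin> zeta ` {..<r} \<Longrightarrow>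
      Y + (\<Sum>i<r. mat (inverse (z - zeta i)) ** R i) = Y' + (\<Sum>i<r. mat (inverse (z - zeta i)) ** R' i)"
  shows "Y = Y'" and "\<And>i. i < r \<Longrightarrow> R i = R' i"
proof -
  have entries: "Y $ a $ b - Y' $ a $ b = 0 \<and> (\<forall>i<r. R i $ a $ b - R' i $ a $ b = 0)" for a b
  proof -
    have "(Y $ a $ b - Y' $ a $ b) + (\<Sum>i<r. (R i $ a $ b - R' i $ a $ b) * inverse (z - zeta i)) = 0"
      if z: "z \<notin> zeta ` {..<r}" for z
      using arg_cong[OF eq[OF z], of "\<lambda>A. A $ a $ b"] unfolding mat_matrix_mult
      by (simp add: sum_subtractf left_diff_distrib mult_ac algebra_simps)
    from partial_fractions_unique_scalar[OF inj this] show ?thesis by blast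
  qed
  show "Y = Y'" using entries by (simp add: vec_eq_iff)
  show "R i = R' i" if "i < r" for i using entries that by (simp add: vec_eq_iff)
qed

lemma transfer_map_in_rat_maps_R:
  fixes q :: "('k::finite, 'l::finite) quad"
  assumes ss: "semisimple_class P r zeta kk" and q: "q \<in> M0" "fst q \<in> P"
  shows "transfer_map r zeta q \<in> rat_maps_R r zeta kk"
proof -
  obtain X Y F G where q_eq: "q = (X, Y, F, G)" by (cases q)
  have X: "X \<in> P" and M: "(X, Y, F, G) \<in> M0" using q by (simp_all add: q_eq)
  obtain Pr where sd: "spectral_decomposition X r zeta Pr" and rk: "\<And>i. i < r \<Longrightarrow> rank (Pr i) = kk i"
    using spectral_decomposition_exists[OF ss X] by blast
  interpret spectral_decomposition X r zeta Pr by (rule sd)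
  have "rank (G ** Pr i ** F) = kk i" if "i < r" for i
    using rank_residue[OF M0_imp_spectrally_stable[OF M] that] rk[OF that] by simp
  then show ?thesis
    unfolding q_eq rat_maps_R_def transfer_map_eq
    by (intro CollectI exI[of _ Y] exI[of _ "\<lambda>i. G ** Pr i ** F"]) simp
qed

lemma transfer_map_eq_iff_gl_orbit:
  fixes q q' :: "('k::finite, 'l::finite) quad"
  assumes ss: "semisimple_class P r zeta kk"
    and q: "q \<in> M0" "fst q \<in> P" and q': "q' \<in> M0" "fst q' \<in> P"
  shows "transfer_map r zeta q = transfer_map r zeta q' \<longleftrightarrow> q' \<in> gl_orbit q"
proof -
  obtain X Y F G where q_eq: "q = (X, Y, F, G)" by (cases q)
  obtain X' Y' F' G' where q'_eq: "q' = (X', Y', F', G')" by (cases q')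
  obtain Pr where sd: "spectral_decomposition X r zeta Pr"
    using spectral_decomposition_exists[OF ss] q(2) q_eq by (metis fst_conv)
  obtain Pr' where sd': "spectral_decomposition X' r zeta Pr'"
    using spectral_decomposition_exists[OF ss] q'(2) q'_eq by (metis fst_conv)
  interpret A: spectral_decomposition X r zeta Pr by (rule sd)
  interpret B: spectral_decomposition X' r zeta Pr' by (rule sd')
  have "q' \<in> gl_orbit q" if "transfer_map r zeta q = transfer_map r zeta q'"
  proof -
    have "Y + (\<Sum>i<r. mat (inverse (z - zeta i)) ** (G ** Pr i ** F)) =
        Y' + (\<Sum>i<r. mat (inverse (z - zeta i)) ** (G' ** Pr' i ** F'))" if "z \<notin> zeta ` {..<r}" for z
      using fun_cong[OF \<open>transfer_map r zeta q = _\<close>, of z] that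
      by (simp add: q_eq q'_eq A.transfer_map_eq B.transfer_map_eq)
    note pf = partial_fractions_unique[OF A.zeta_inj this]
    show ?thesis
      using equal_residues_imp_same_orbit[OF sd sd' A.M0_imp_spectrally_stable B.M0_imp_spectrally_stable
          pf(2)[symmetric]] q(1) q'(1)
      by (simp add: q_eq q'_eq pf(1))
  qed
  moreover have "transfer_map r zeta q = transfer_map r zeta q'" if orbit: "q' \<in> gl_orbit q"
  proof -
    obtain g where g: "invertible g" "q' = gl_act g q"
      using orbit unfolding gl_orbit_def by blast
    show ?thesis unfolding g(2) q_eq A.transfer_map_gl_act[OF g(1)] ..
  qed
  ultimately show ?thesis by blast
qed

lemma rat_maps_R_realized:
  fixes P :: "(complex^'k::finite^'k) set"
  assumes ss: "semisimple_class P r zeta kk" and R: "R \<in> rat_maps_R r zeta kk"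
  obtains q :: "('k, 'l::finite) quad" where "q \<in> M0" "fst q \<in> P" "transfer_map r zeta q = R"
proof -
  obtain Y :: "complex^'l^'l" and Rs where R_eq: "R = (\<lambda>z. if z \<in> zeta ` {..<r} then 0
      else Y + (\<Sum>i<r. mat (inverse (z - zeta i)) ** Rs i))" and rk: "\<And>i. i < r \<Longrightarrow> rank (Rs i) = kk i"
    using R unfolding rat_maps_R_def by blast
  obtain X0 :: "complex^'k^'k" where P_eq: "P = {g ** X0 ** matrix_inv g | g. invertible g}"
    using ss unfolding semisimple_class_def by blast
  have X0: "X0 \<in> P"
    unfolding P_eq using invertible_mat_1 by (force simp: matrix_inv_mat_1)
  obtain Pr where sd: "spectral_decomposition X0 r zeta Pr" and rkP: "\<And>i. i < r \<Longrightarrow> rank (Pr i) = kk i"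
    using spectral_decomposition_exists[OF ss X0] by blast
  interpret spectral_decomposition X0 r zeta Pr by (rule sd)
  obtain F G where st: "spectrally_stable r Pr F G" and res: "\<And>i. i < r \<Longrightarrow> G ** Pr i ** F = Rs i"
    using realize_residues[of Rs] rk rkP by metis
  have residues: "(\<Sum>i<r. mat (inverse (z - zeta i)) ** (G ** Pr i ** F)) =
      (\<Sum>i<r. mat (inverse (z - zeta i)) ** Rs i)" for z
    by (rule sum.cong) (simp_all add: res)
  have "transfer_map r zeta (X0, Y, F, G) = R"
    unfolding transfer_map_eq R_eq residues ..
  with spectrally_stable_imp_M0[OF st] X0 show thesis by (intro that[of "(X0, Y, F, G)"]) simp_all
qed

theorem lemma4p3:
  fixes P :: "(complex^'k::finite^'k) set"
    and r :: nat and zeta :: "nat \<Rightarrow> complex" and kk :: "nat \<Rightarrow> nat"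
  assumes "semisimple_class P r zeta kk"
  defines "S \<equiv> {q :: ('k, 'l::finite) quad. q \<in> M0 \<and> fst q \<in> P}"
  shows "(\<forall>q\<in>S. transfer_map r zeta q \<in> rat_maps_R r zeta kk)
    \<and> (\<forall>q\<in>S. \<forall>q'\<in>S. transfer_map r zeta q = transfer_map r zeta q' \<longleftrightarrow> q' \<in> gl_orbit q)
    \<and> (\<forall>R\<in>rat_maps_R r zeta kk. \<exists>q\<in>S. transfer_map r zeta q = R)"
proof (intro conjI ballI)
  show "transfer_map r zeta q \<in> rat_maps_R r zeta kk" if "q \<in> S" for q
    using that unfolding S_def by (intro transfer_map_in_rat_maps_R[OF assms(1)]) simp_all
  show "transfer_map r zeta q = transfer_map r zeta q' \<longleftrightarrow> q' \<in> gl_orbit q" if "q \<in> S" "q' \<in> S" for q q'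
    using that unfolding S_def by (intro transfer_map_eq_iff_gl_orbit[OF assms(1)]) simp_all
  show "\<exists>q\<in>S. transfer_map r zeta q = R" if R: "R \<in> rat_maps_R r zeta kk" for R
  proof -
    obtain q :: "('k, 'l) quad" where "q \<in> M0" "fst q \<in> P" "transfer_map r zeta q = R"
      using rat_maps_R_realized[OF assms(1) R] .
    then show ?thesis unfolding S_def by blast
  qed
qed

end
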